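(* Let $\mathbb{F}$ be a field of characteristic different from two, let $n\ge 3$, and let $\Phi\colon \mathrm{Mat}_n(\mathbb{F})\to \mathrm{Mat}_n(\mathbb{F})$ be an additive map such that $\Phi(\Lambda^1)\subseteq\Lambda^1$. Then either there exist $i,j,i',j'\in[n]$ such that at least one of $$\Phi(\mathrm{Mat}_n(\mathbb{F}))\subseteq\mathcal{R}_i,\qquad \Phi(\mathrm{Mat}_n(\mathbb{F}))\subseteq\mathcal{C}_j,\qquad \Phi(\mathrm{Mat}_n(\mathbb{F}))\subseteq(\mathcal{R}_i+\mathcal{R}_{i'})\cap(\mathcal{C}_j+\mathcal{C}_{j'})$$ holds, or else there exist transformations (arbitrary maps, not necessarily injective) $\sigma,\tau\colon[n]\to[n]$, diagonal matrices $D_1,D_2\in\mathrm{Mat}_n(\mathbb{F})$ with nonzero diagonal entries, and a nonzero field endomorphism $\varphi$ of $\mathbb{F}$ such that $$\Phi(A)=P_\sigma^{T}D_1A^{\varphi}D_2P_\tau\quad\text{for all }A\in\mathrm{Mat}_n(\mathbb{F}),$$ or $$\Phi(A)=P_\sigma^{T}D_1(A^{\varphi})^{T}D_2P_\tau\quad\text{for all }A\in\mathrm{Mat}_n(\mathbb{F}).$$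
   Context: $[n]=\{1,\dots,n\}$; $\mathrm{Mat}_n(\mathbb{F})$ is the set of $n\times n$ matrices over $\mathbb{F}$. The permanent of an $m\times m$ matrix $A=(a_{ij})$ is $\mathrm{per}(A)=\sum_{\pi\in S_m}\prod_{i=1}^m a_{i\pi(i)}$. The permanent rank $\mathrm{prk}(A)$ of $A\in\mathrm{Mat}_n(\mathbb{F})$ is the size of the largest square submatrix of $A$ with nonzero permanent (and $\mathrm{prk}(0)=0$). $\Lambda^1=\{A\in\mathrm{Mat}_n(\mathbb{F}) : \mathrm{prk}(A)=1\}$. $\mathcal{R}_i$ is the set of matrices in $\mathrm{Mat}_n(\mathbb{F})$ all of whose entries outside the $i$-th row are zero; $\mathcal{C}_j$ is the set of matrices all of whose entries outside the $j$-th column are zero. $E_{ij}$ are the standard matrix units. For a map $\sigma\colon[n]\to[n]$, $P_\sigma=\sum_{i=1}^nE_{i\sigma(i)}$. A field endomorphism is an additive and multiplicative map $\varphi\colon\mathbb{F}\to\mathbb{F}$; for $A=(a_{ij})$, $A^\varphi=(\varphi(a_{ij}))$. "Additive" means $\Phi(A+B)=\Phi(A)+\Phi(B)$. *)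

theory Defs
  imports "Jordan_Normal_Form.DL_Submatrix" "HOL-Combinatorics.Permutations" "HOL-Library.Set_Algebras"
begin

text \<open>
  Matrices are those of Jordan_Normal_Form: \<open>Mat\<^sub>n(\<bbbF>)\<close> is \<^term>\<open>carrier_mat n n\<close> and the index set
  \<open>[n]\<close> is \<^term>\<open>{..<n}\<close>, i.e.\ rows and columns are numbered from \<open>0\<close>.
\<close>

text \<open>Meaningful for square matrices only; the permanent of the empty matrix is \<open>1\<close>.\<close>
definition permanent :: "'a::comm_semiring_1 mat \<Rightarrow> 'a" where
  "permanent A = (\<Sum>p\<in>{p. p permutes {0..<dim_row A}}. \<Prod>i = 0..<dim_row A. A $$ (i, p i))"

text \<open>
  The set below is finite and always contains \<open>0\<close> (take \<open>I = J = {}\<close>), so the maximum is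
  attained, and the zero matrix gets permanent rank \<open>0\<close> without a special case.
\<close>
definition permanent_rank :: "'a::comm_semiring_1 mat \<Rightarrow> nat" where
  "permanent_rank A = Max {m. \<exists>I J. I \<subseteq> {..<dim_row A} \<and> J \<subseteq> {..<dim_col A}
     \<and> card I = m \<and> card J = m \<and> permanent (submatrix A I J) \<noteq> 0}"

lemma permanent_rank_zero_mat: "permanent_rank (0\<^sub>m n n :: 'a::comm_semiring_1 mat) = 0"
proof -
  have "card I = 0" if "I \<subseteq> {..<n}" "card I = card J" "J \<subseteq> {..<n}"
    and ne: "permanent (submatrix (0\<^sub>m n n :: 'a mat) I J) \<noteq> 0" for I J
  proof (rule ccontr)
    assume pos: "card I \<noteq> 0"
    have c: "card {i. i < n \<and> i \<in> I} = card I" "card {j. j < n \<and> j \<in> J} = card J"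
    proof -
      have "{i. i < n \<and> i \<in> I} = I" "{j. j < n \<and> j \<in> J} = J"
        using that by auto
      thus "card {i. i < n \<and> i \<in> I} = card I" "card {j. j < n \<and> j \<in> J} = card J"
        by simp_all
    qed
    have "(\<Prod>i = 0..<card I. submatrix (0\<^sub>m n n :: 'a mat) I J $$ (i, p i)) = 0"
      if p: "p permutes {0..<card I}" for p
    proof (rule prod_zero)
      have "p 0 < card I" using permutes_in_image[OF p, of 0] pos by auto
      moreover from this have "pick I 0 < n" "pick J (p 0) < n"
        using pick_le[of 0 n I] pick_le[of "p 0" n J] c pos \<open>card I = card J\<close> by auto
      ultimately show "\<exists>i\<in>{0..<card I}. submatrix (0\<^sub>m n n :: 'a mat) I J $$ (i, p i) = 0"
        using pos c \<open>card I = card J\<close> by (intro bexI[of _ 0]) (auto simp: submatrix_def)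
    qed simp
    hence "permanent (submatrix (0\<^sub>m n n :: 'a mat) I J) = 0"
      unfolding permanent_def using c by (simp add: dim_submatrix)
    with ne show False by simp
  qed
  moreover have "permanent (submatrix (0\<^sub>m n n :: 'a mat) {} {}) \<noteq> 0"
    by (simp add: permanent_def submatrix_def)
  ultimately have "{m. \<exists>I J. I \<subseteq> {..<n} \<and> J \<subseteq> {..<n} \<and> card I = m \<and> card J = m
     \<and> permanent (submatrix (0\<^sub>m n n :: 'a mat) I J) \<noteq> 0} = {0}"
    by (auto intro!: exI[of _ "{}"]) metis
  thus ?thesis by (simp add: permanent_rank_def)
qed

definition Lambda1 :: "nat \<Rightarrow> 'a::comm_semiring_1 mat set" where
  "Lambda1 n = {A \<in> carrier_mat n n. permanent_rank A = 1}"

definition row_mats :: "nat \<Rightarrow> nat \<Rightarrow> 'a::zero mat set" where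
  "row_mats n i = {A \<in> carrier_mat n n. \<forall>k<n. \<forall>l<n. k \<noteq> i \<longrightarrow> A $$ (k, l) = 0}"

definition col_mats :: "nat \<Rightarrow> nat \<Rightarrow> 'a::zero mat set" where
  "col_mats n j = {A \<in> carrier_mat n n. \<forall>k<n. \<forall>l<n. l \<noteq> j \<longrightarrow> A $$ (k, l) = 0}"

definition unit_matrix :: "nat \<Rightarrow> nat \<Rightarrow> nat \<Rightarrow> 'a::zero_neq_one mat" where
  "unit_matrix n i j = mat n n (\<lambda>(k, l). if k = i \<and> l = j then 1 else 0)"

text \<open>
  The sum of the matrix units \<open>E\<^bsub>i \<sigma>(i)\<^esub>\<close> is taken entrywise, since the type of all matrices
  is not a monoid under addition.
\<close>
definition map_matrix :: "nat \<Rightarrow> (nat \<Rightarrow> nat) \<Rightarrow> 'a::comm_semiring_1 mat" where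
  "map_matrix n \<sigma> = mat n n (\<lambda>(k, l). \<Sum>i<n. unit_matrix n i (\<sigma> i) $$ (k, l))"

text \<open>\<open>\<phi> 1 = 1\<close> is not part of the definition; the zero map is a field endomorphism in this sense.\<close>
definition field_endomorphism :: "('a::field \<Rightarrow> 'a) \<Rightarrow> bool" where
  "field_endomorphism \<phi> \<longleftrightarrow>
     (\<forall>x y. \<phi> (x + y) = \<phi> x + \<phi> y) \<and> (\<forall>x y. \<phi> (x * y) = \<phi> x * \<phi> y)"

definition nonsingular_diagonal :: "nat \<Rightarrow> 'a::zero mat \<Rightarrow> bool" where
  "nonsingular_diagonal n D \<longleftrightarrow>
     D \<in> carrier_mat n n \<and> diagonal_mat D \<and> (\<forall>i<n. D $$ (i, i) \<noteq> 0)"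

end

theory Submission
  imports Defs "Jordan_Normal_Form.Determinant"
begin

text \<open>
  A matrix has permanent rank at most one iff it is isotropic for all the quadratic forms
  \<open>x\<^bsub>rc\<^esub> x\<^bsub>r'c'\<^esub> + x\<^bsub>rc'\<^esub> x\<^bsub>r'c\<^esub>\<close> (the \<open>2 \<times> 2\<close> permanents). Let \<open>\<phi>\<^bsub>ij\<^esub>(a)\<close> be the
  image of \<open>a E\<^bsub>ij\<^esub>\<close>. Polarising the hypothesis on matrices supported in one row, in one column or
  in a \<open>2 \<times> 2\<close> block shows that images of units in a common line are orthogonal and that
  \<open>\<phi>\<^bsub>ij\<^esub>(a), \<phi>\<^bsub>kl\<^esub>(d)\<close> pair exactly like \<open>\<phi>\<^bsub>il\<^esub>(b), \<phi>\<^bsub>kj\<^esub>(c)\<close> whenever \<open>ad = bc\<close>. If all these pairings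
  vanish, the image is an isotropic group, hence lies in a row, a column or a \<open>2 \<times> 2\<close> block. If a
  pairing is nonzero at a minor \<open>K\<close>, the four images form two orthogonal hyperbolic pairs; these span
  the four-dimensional space of matrices supported in \<open>K\<close>, and all four are themselves supported in
  \<open>K\<close>. Either every image is supported in \<open>K\<close>, or a third row or column leads to a second minor
  \<open>K'\<close>, and comparing \<open>K\<close> with \<open>K'\<close> forces the four images to be multiples of matrix units.
  From there the cell property spreads to all \<open>\<phi>\<^bsub>ij\<^esub>\<close>, and the relation for \<open>ad = bc\<close> makes the
  scalars have the form \<open>d\<^sub>i e\<^sub>j h(a)\<close> with \<open>h\<close> multiplicative.
\<close>

section \<open>The polar form of the \<open>2 \<times> 2\<close> permanents\<close>

text \<open>Additivity says nothing about how the images of different multiples of one matrix unit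
  are related. They become comparable through the polar form: it is nondegenerate on the matrices
  supported in a minor, so an image orthogonal to three members of a hyperbolic quadruple is a
  multiple of one of them. Thus a single nonzero pairing at \<open>i, j\<close> makes all the images
  of multiples of that unit proportional. Characteristic two is excluded because of a sign. Two
  matrices that occupy different columns of rows \<open>r, r'\<close> are orthogonal there iff the
  ratios of their row entries are opposite. Going round three pairwise orthogonal columns gives
  \<open>t = - t\<close>, which forces a zero; with determinants the ratios would be equal and
  nothing would follow. A further obstacle is that different rows or columns of the domain may be
  sent to the same line, so that relations between scalars can be read off only at positions that
  differ; the others need a detour through an auxiliary index.\<close>

text \<open>
  Matrices are treated as functions on arbitrary index types; this makes rows and columns
  interchangeable (via \<open>tr\<close> below).
\<close>
definition pol :: "('r \<Rightarrow> 'c \<Rightarrow> 'a::field) \<Rightarrow> ('r \<Rightarrow> 'c \<Rightarrow> 'a) \<Rightarrow> 'r \<Rightarrow> 'r \<Rightarrow> 'c \<Rightarrow> 'c \<Rightarrow> 'a" where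
  "pol u v r r' c c' = u r c * v r' c' + u r' c' * v r c + u r c' * v r' c + u r' c * v r c'"

definition perp :: "('r \<Rightarrow> 'c \<Rightarrow> 'a::field) \<Rightarrow> ('r \<Rightarrow> 'c \<Rightarrow> 'a) \<Rightarrow> bool" where
  "perp u v \<longleftrightarrow> (\<forall>r r' c c'. r \<noteq> r' \<longrightarrow> c \<noteq> c' \<longrightarrow> pol u v r r' c c' = 0)"

definition supp_in :: "('r \<Rightarrow> 'c \<Rightarrow> 'a::field) \<Rightarrow> 'r set \<Rightarrow> 'c set \<Rightarrow> bool" where
  "supp_in u R C \<longleftrightarrow> (\<forall>p q. u p q \<noteq> 0 \<longrightarrow> p \<in> R \<and> q \<in> C)"

definition tr :: "('r \<Rightarrow> 'c \<Rightarrow> 'a) \<Rightarrow> 'c \<Rightarrow> 'r \<Rightarrow> 'a" where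
  "tr u = (\<lambda>q p. u p q)"

lemma pol_sym: "pol u v r r' c c' = pol v u r r' c c'"
  by (simp add: pol_def algebra_simps)

lemma pol_swap_rows: "pol u v r' r c c' = pol u v r r' c c'"
  by (simp add: pol_def algebra_simps)

lemma pol_swap_cols: "pol u v r r' c' c = pol u v r r' c c'"
  by (simp add: pol_def algebra_simps)

lemma pol_tr: "pol (tr u) (tr v) c c' r r' = pol u v r r' c c'"
  by (simp add: pol_def tr_def algebra_simps)

lemma perp_sym: "perp u v \<longleftrightarrow> perp v u"
  by (simp add: perp_def pol_sym)

lemma perp_tr [simp]: "perp (tr u) (tr v) \<longleftrightarrow> perp u v"
  unfolding perp_def pol_tr by blast

lemma supp_in_tr [simp]: "supp_in (tr u) C R \<longleftrightarrow> supp_in u R C"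
  unfolding supp_in_def tr_def by blast

text \<open>
  Two orthogonal hyperbolic pairs span the four-dimensional space of matrices supported in the minor,
  so every matrix is expanded in the dual basis. With \<open>A\<close> and \<open>B\<close> the matrices of the quadruple and
  of its dual, the hypotheses say \<open>AB = 1\<close> and the claim is \<open>BA = 1\<close>.
\<close>
lemma hyperbolic_expansion:
  fixes x y z w :: "'r \<Rightarrow> 'c \<Rightarrow> 'a::field"
    and P :: "('r \<Rightarrow> 'c \<Rightarrow> 'a) \<Rightarrow> ('r \<Rightarrow> 'c \<Rightarrow> 'a) \<Rightarrow> 'a"
  assumes P_def: "\<And>u v. P u v = pol u v r r' c c'"
    and T: "P x y = T" "P z w = T" "T \<noteq> 0"
    and 0: "P x x = 0" "P y y = 0" "P z z = 0" "P w w = 0"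
      "P x z = 0" "P x w = 0" "P y z = 0" "P y w = 0"
    and p: "p \<in> {r, r'}" and q: "q \<in> {c, c'}"
  shows "T * u p q = P u y * x p q + P u x * y p q + P u w * z p q + P u z * w p q"
proof -
  define A where "A = mat 4 4 (\<lambda>(i, j). ([x, y, z, w] ! i) ([r, r, r', r'] ! j) ([c, c', c, c'] ! j))"
  define B where "B = mat 4 4 (\<lambda>(j, i). ([y, x, w, z] ! i) ([r', r', r, r] ! j) ([c', c, c', c] ! j) / T)"
  have A: "A \<in> carrier_mat 4 4" and B: "B \<in> carrier_mat 4 4"
    by (auto simp: A_def B_def)
  have ex4: "(\<forall>i<4. Q i) \<longleftrightarrow> Q 0 \<and> Q 1 \<and> Q 2 \<and> Q 3" for Q :: "nat \<Rightarrow> bool"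
    by (auto simp: numeral_eq_Suc less_Suc_eq)
  have sum4: "(\<Sum>i = 0..<4. g i) = g 0 + g 1 + g 2 + g 3" for g :: "nat \<Rightarrow> 'a"
    by (simp add: numeral_eq_Suc)
  have "\<forall>i<4. \<forall>j<4. T * (A * B) $$ (i, j) = T * 1\<^sub>m 4 $$ (i, j)"
    unfolding ex4 using T 0
    by (simp add: A_def B_def scalar_prod_def sum4 P_def pol_def algebra_simps)
  hence "A * B = 1\<^sub>m 4"
    using A B T(3) by (intro eq_matI) auto
  hence BA: "B * A = 1\<^sub>m 4"
    using mat_mult_left_right_inverse[OF A B] by blast
  have eqs: "\<forall>i<4. \<forall>j<4. (\<Sum>k=0..<4. ([y, x, w, z] ! k) ([r', r', r, r] ! i) ([c', c, c', c] ! i) *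
      ([x, y, z, w] ! k) ([r, r, r', r'] ! j) ([c, c', c, c'] ! j)) = (if i = j then T else 0)"
  proof (intro allI impI)
    fix i j :: nat assume ij: "i < 4" "j < 4"
    have "(B * A) $$ (i, j) = (\<Sum>k=0..<4. ([y, x, w, z] ! k) ([r', r', r, r] ! i) ([c', c, c', c] ! i) *
      ([x, y, z, w] ! k) ([r, r, r', r'] ! j) ([c, c', c, c'] ! j)) / T"
      using ij by (simp add: A_def B_def scalar_prod_def sum4 add_divide_distrib)
    thus "(\<Sum>k=0..<4. ([y, x, w, z] ! k) ([r', r', r, r] ! i) ([c', c, c', c] ! i) *
      ([x, y, z, w] ! k) ([r, r, r', r'] ! j) ([c, c', c, c'] ! j)) = (if i = j then T else 0)"
      using ij T(3) unfolding BA by (auto simp: divide_eq_eq split: if_splits)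
  qed
  have "P u y * x p q + P u x * y p q + P u w * z p q + P u z * w p q =
     u r c * (y r' c' * x p q + x r' c' * y p q + w r' c' * z p q + z r' c' * w p q)
     + u r c' * (y r' c * x p q + x r' c * y p q + w r' c * z p q + z r' c * w p q)
     + u r' c * (y r c' * x p q + x r c' * y p q + w r c' * z p q + z r c' * w p q)
     + u r' c' * (y r c * x p q + x r c * y p q + w r c * z p q + z r c * w p q)"
    by (simp add: P_def pol_def algebra_simps)
  also have "\<dots> = T * u p q"
    using p q eqs unfolding ex4 by (auto simp: sum4)
  finally show ?thesis by simp
qed

section \<open>Bilinearity, and quadruples that are dual at every minor\<close>

lemma pol_add_left: "pol (\<lambda>p q. u p q + v p q) w r r' c c' = pol u w r r' c c' + pol v w r r' c c'"
  by (simp add: pol_def algebra_simps)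

lemma pol_add_right: "pol w (\<lambda>p q. u p q + v p q) r r' c c' = pol w u r r' c c' + pol w v r r' c c'"
  by (simp add: pol_def algebra_simps)

lemma pol_scale_left: "pol (\<lambda>p q. a * u p q) w r r' c c' = a * pol u w r r' c c'"
  by (simp add: pol_def algebra_simps)

lemma pol_scale_right: "pol w (\<lambda>p q. a * u p q) r r' c c' = a * pol w u r r' c c'"
  by (simp add: pol_def algebra_simps)

lemmas pol_linear = pol_add_left pol_add_right pol_scale_left pol_scale_right

text \<open>The relations between the images of \<open>a E\<^bsub>ij\<^esub>, d E\<^bsub>kl\<^esub>, b E\<^bsub>il\<^esub>, c E\<^bsub>kj\<^esub>\<close> when \<open>ad = bc\<close>.\<close>
definition dual_quad :: "('r \<Rightarrow> 'c \<Rightarrow> 'a::field) \<Rightarrow> ('r \<Rightarrow> 'c \<Rightarrow> 'a) \<Rightarrow> ('r \<Rightarrow> 'c \<Rightarrow> 'a) \<Rightarrow>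
    ('r \<Rightarrow> 'c \<Rightarrow> 'a) \<Rightarrow> bool" where
  "dual_quad x y z w \<longleftrightarrow> perp x x \<and> perp y y \<and> perp z z \<and> perp w w \<and>
     perp x z \<and> perp x w \<and> perp y z \<and> perp y w \<and>
     (\<forall>r r' c c'. r \<noteq> r' \<longrightarrow> c \<noteq> c' \<longrightarrow> pol x y r r' c c' = pol z w r r' c c')"

lemma dual_quad_tr [simp]: "dual_quad (tr x) (tr y) (tr z) (tr w) \<longleftrightarrow> dual_quad x y z w"
  unfolding dual_quad_def perp_tr pol_tr by blast

text \<open>Entries in a further column \<open>q\<close> are tested against the unit entries in
  columns \<open>c\<close> and \<open>c'\<close>. Half of them vanish at once. For the others,
  columns \<open>c, q\<close> give \<open>fd r' q = fb r q\<close> while \<open>c', q\<close> give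
  \<open>fd r' q = - fb r q\<close> (likewise for \<open>fa r q\<close> and \<open>fc r' q\<close>,
  with the signs exchanged), so dividing by 2 finishes.\<close>

lemma unit_quad_cols:
  fixes fa fb fc fd :: "'r \<Rightarrow> 'c \<Rightarrow> 'a::field"
  assumes two: "(2::'a) \<noteq> 0" and K: "r \<noteq> r'" "c \<noteq> c'" "q \<notin> {c, c'}"
    and quad: "dual_quad fa fd fb fc"
    and units: "fa r c = 1" "fa r c' = 0" "fa r' c = 0" "fa r' c' = 0"
      "fb r c = 0" "fb r c' = 1" "fb r' c = 0" "fb r' c' = 0"
      "fc r c = 0" "fc r c' = 0" "fc r' c = 1" "fc r' c' = 0"
      "fd r c = 0" "fd r c' = 0" "fd r' c = 0" "fd r' c' = 1"
  shows "f \<in> {fa, fb, fc, fd} \<Longrightarrow> p \<in> {r, r'} \<Longrightarrow> f p q = 0"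
proof -
  have q: "c \<noteq> q" "c' \<noteq> q" using K by auto
  have d: "a = 0" if "a + a = 0" for a :: 'a
    using that two by (metis mult_2 mult_eq_0_iff)
  have "pol fa fa r r' c q = 0" "pol fa fb r r' c q = 0" "pol fa fc r r' c q = 0" "pol fc fc r r' c q = 0" "pol fd fc r r' c q = 0"
     "pol fa fd r r' c q = pol fb fc r r' c q"
     "pol fb fb r r' c' q = 0" "pol fd fb r r' c' q = 0" "pol fd fd r r' c' q = 0" "pol fa fb r r' c' q = 0"
     "pol fa fd r r' c' q = pol fb fc r r' c' q"
    using quad K(1) q unfolding dual_quad_def perp_def by simp_all
  note * = this[unfolded pol_def units, simplified]
  have "fd r' q = fb r q" "fb r q = - fd r' q" "fc r' q = fa r q" "fa r q = - fc r' q"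
    using * by (auto simp: eq_neg_iff_add_eq_0 add.commute)
  hence "fd r' q = 0" "fb r q = 0" "fc r' q = 0" "fa r q = 0"
    using d by (metis add.right_inverse)+
  moreover have "fa r' q = 0" "fb r' q = 0" "fc r q = 0" "fd r q = 0" using * two by auto
  ultimately show "f \<in> {fa, fb, fc, fd} \<Longrightarrow> p \<in> {r, r'} \<Longrightarrow> f p q = 0"  by auto
qed

text \<open>Transposing exchanges the roles of \<open>fb\<close> and \<open>fc\<close> and turns the
  result on columns into one on rows. After that, an entry \<open>f p q\<close> outside both strips
  is, up to a factor 2 for \<open>f = fa\<close>, its pairing with \<open>fa\<close> across
  \<open>r, p\<close> and \<open>c, q\<close>, because \<open>fa r c = 1\<close>.\<close>

lemma unit_quad_supp:
  fixes fa fb fc fd :: "'r \<Rightarrow> 'c \<Rightarrow> 'a::field"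
  assumes two: "(2::'a) \<noteq> 0" and K: "r \<noteq> r'" "c \<noteq> c'"
    and quad: "dual_quad fa fd fb fc"
    and units: "fa r c = 1" "fa r c' = 0" "fa r' c = 0" "fa r' c' = 0"
      "fb r c = 0" "fb r c' = 1" "fb r' c = 0" "fb r' c' = 0"
      "fc r c = 0" "fc r c' = 0" "fc r' c = 1" "fc r' c' = 0"
      "fd r c = 0" "fd r c' = 0" "fd r' c = 0" "fd r' c' = 1"
    and f: "f \<in> {fa, fb, fc, fd}"
  shows "supp_in f {r, r'} {c, c'}"
proof -
  have cols: "f p q = 0" if "f \<in> {fa, fb, fc, fd}" "p \<in> {r, r'}" "q \<notin> {c, c'}" for f p q
    using unit_quad_cols[OF two K that(3) quad units that(1,2)] .
  have quad': "dual_quad (tr fa) (tr fd) (tr fc) (tr fb)"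
    using quad unfolding dual_quad_def perp_tr pol_tr using perp_sym pol_sym by metis
  have rows: "f p q = 0" if "f \<in> {fa, fb, fc, fd}" "p \<notin> {r, r'}" "q \<in> {c, c'}" for f p q
    using unit_quad_cols[OF two K(2,1) that(2) quad', of "tr f" q] units that(1,3)
    by (auto simp: tr_def)
  have out: "f p q = 0" if "f \<in> {fa, fb, fc, fd}" "p \<notin> {r, r'}" "q \<notin> {c, c'}" for f p q
  proof -
    have pq: "r \<noteq> p" "c \<noteq> q" using that by auto
    have "pol fa fa r p c q = 0" "pol fa fb r p c q = 0" "pol fa fc r p c q = 0" "pol fa fd r p c q = pol fb fc r p c q"
      using quad pq unfolding dual_quad_def perp_def by metis+
    note * = this[unfolded pol_def units]
    have z: "fa r q = 0" "fa p c = 0" "fb r q = 0" "fb p c = 0" "fc r q = 0" "fc p c = 0" "fd r q = 0" "fd p c = 0"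
      using cols rows that by auto
    show ?thesis using *[unfolded z] that(1) two by auto
  qed
  show ?thesis unfolding supp_in_def using cols rows out f by metis
qed

text \<open>A change of basis reduces this to \<open>unit_quad_supp\<close>: certain combinations of
  \<open>x, y, z, w\<close> restrict to the four matrix units on the minor and are again dual at
  every minor, and \<open>x, y, z, w\<close> are in turn combinations of them.\<close>

lemma quad_supp:
  fixes x y z w :: "'r \<Rightarrow> 'c \<Rightarrow> 'a::field"
  assumes two: "(2::'a) \<noteq> 0" and K: "r \<noteq> r'" "c \<noteq> c'"
    and quad: "dual_quad x y z w" and nz: "pol x y r r' c c' \<noteq> 0"
    and g: "g \<in> {x, y, z, w}"
  shows "supp_in g {r, r'} {c, c'}"
proof -
  define T where "T = pol x y r r' c c'"
  define P where "P u v = pol u v r r' c c'" for u v :: "'r \<Rightarrow> 'c \<Rightarrow> 'a"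
  define E where "E p q = (\<lambda>s t. if s = p \<and> t = q then 1 else (0::'a))" for p :: 'r and q :: 'c
  define i where "i = 1 / T"
  \<comment> \<open>The right-hand side of \<open>hyperbolic_expansion\<close>, read at all
    positions: \<open>F u\<close> lies in the span of the quadruple and agrees with \<open>u\<close>
    on the minor.\<close>
  define F where "F u = (\<lambda>s t. i * (P u y * x s t + P u x * y s t + P u w * z s t + P u z * w s t))" for u
  have T: "P x y = T" "P z w = T" "T \<noteq> 0"
    and 0: "P x x = 0" "P y y = 0" "P z z = 0" "P w w = 0"
      "P x z = 0" "P x w = 0" "P y z = 0" "P y w = 0"
    using quad nz K unfolding T_def P_def dual_quad_def perp_def by metis+
  have exp: "F u p q = u p q" if "p \<in> {r, r'}" "q \<in> {c, c'}" for u p q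
    using hyperbolic_expansion[OF P_def T 0 that, of u] T(3)
    by (simp add: F_def i_def field_simps)
  have iT: "i * T = 1" using T(3) by (simp add: i_def)
  have Fpol: "pol (F u) (F v) s s' t t' = pol x y s s' t t' * i * P u v"
    if st: "s \<noteq> s'" "t \<noteq> t'" for u v s s' t t'
  proof -
    have z: "pol z w s s' t t' = pol x y s s' t t'"
      "pol x x s s' t t' = 0" "pol y y s s' t t' = 0" "pol z z s s' t t' = 0" "pol w w s s' t t' = 0"
      "pol x z s s' t t' = 0" "pol x w s s' t t' = 0" "pol y z s s' t t' = 0" "pol y w s s' t t' = 0"
      using quad st unfolding dual_quad_def perp_def by metis+
    define Q where "Q = P u y * P v x + P u x * P v y + P u w * P v z + P u z * P v w"
    \<comment> \<open>Only the dual pairs contribute, both with the value of \<open>pol x y\<close>.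
      The claim is used twice: at \<open>s, s', t, t'\<close>, and at the minor itself, where
      \<open>F u\<close> and \<open>F v\<close> are \<open>u\<close> and \<open>v\<close>; the
      latter shows \<open>Q = T * P u v\<close>.\<close>
    have gen: "pol (F u) (F v) s s' t t' = i * i * (pol x y s s' t t' * Q)"
      if z: "pol z w s s' t t' = pol x y s s' t t'"
      "pol x x s s' t t' = 0" "pol y y s s' t t' = 0" "pol z z s s' t t' = 0" "pol w w s s' t t' = 0"
      "pol x z s s' t t' = 0" "pol x w s s' t t' = 0" "pol y z s s' t t' = 0" "pol y w s s' t t' = 0"
    for s s' t t'
    proof -
      have "pol (F u) (F v) s s' t t' = i * (i * (P u y * (P v x * pol x y s s' t t') +
        P u x * (P v y * pol x y s s' t t') + P u w * (P v z * pol x y s s' t t') + P u z * (P v w * pol x y s s' t t')))"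
        unfolding F_def pol_linear
        by (simp add: z distrib_left pol_sym[of y x] pol_sym[of w z] pol_sym[of z x] pol_sym[of w x] pol_sym[of z y] pol_sym[of w y])
      thus ?thesis unfolding Q_def by (simp add: distrib_left distrib_right mult_ac)
    qed
    have "P (F u) (F v) = P u v" by (simp add: P_def pol_def exp)
    moreover have "P (F u) (F v) = i * i * (T * Q)"
      using gen[of r r' c c'] T 0 unfolding P_def by simp
    ultimately have "P u v = (i * T) * i * Q" by (simp add: mult_ac)
    thus ?thesis using gen[OF z] by (simp add: iT[unfolded mult.commute[of i]] mult_ac)
  qed
  have PE: "P (E r c) u = u r' c'" "P (E r' c') u = u r c" "P (E r c') u = u r' c" "P (E r' c) u = u r c'" for u
    using K by (simp_all add: P_def pol_def E_def)
  have EE: "E p q p q = 1" "p' \<noteq> p \<Longrightarrow> E p q p' q' = 0" "q' \<noteq> q \<Longrightarrow> E p q p' q' = 0" for p p' q q'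
    by (auto simp: E_def)
  note K' = K[symmetric]
  have quad: "dual_quad (F (E r c)) (F (E r' c')) (F (E r c')) (F (E r' c))"
    unfolding dual_quad_def perp_def using K K' by (simp add: Fpol PE EE)
  have sup: "supp_in f {r, r'} {c, c'}"
    if "f \<in> {F (E r c), F (E r c'), F (E r' c), F (E r' c')}" for f
    using K K' by (intro unit_quad_supp[OF two K quad _ _ _ _ _ _ _ _ _ _ _ _ _ _ _ _ that])
      (simp_all add: exp EE)
  have expand: "g s t = g r c * F (E r c) s t + g r c' * F (E r c') s t + g r' c * F (E r' c) s t + g r' c' * F (E r' c') s t" for s t
  proof -
    have "g r c * F (E r c) s t + g r c' * F (E r c') s t + g r' c * F (E r' c) s t + g r' c' * F (E r' c') s t
       = i * (P g y * x s t + P g x * y s t + P g w * z s t + P g z * w s t)"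
      unfolding F_def PE unfolding P_def pol_def by (simp add: algebra_simps)
    also have "P g y * x s t + P g x * y s t + P g w * z s t + P g z * w s t = T * g s t" using g T 0 unfolding P_def
      by (auto simp: pol_sym[of y x] pol_sym[of w z] pol_sym[of z x] pol_sym[of w x] pol_sym[of z y] pol_sym[of w y])
    also have "i * (T * g s t) = g s t" using iT by (simp add: mult.assoc[symmetric])
    finally show ?thesis by simp
  qed
  show ?thesis unfolding supp_in_def
  proof (intro allI impI, rule ccontr)
    fix s t assume "g s t \<noteq> 0" and out: "\<not> (s \<in> {r, r'} \<and> t \<in> {c, c'})"
    have "f s t = 0" if "f \<in> {F (E r c), F (E r c'), F (E r' c), F (E r' c')}" for f
      using sup[OF that] out unfolding supp_in_def by blast
    hence "F (E r c) s t = 0" "F (E r c') s t = 0" "F (E r' c) s t = 0" "F (E r' c') s t = 0" by blast+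
    thus False using \<open>g s t \<noteq> 0\<close> expand[of s t] by simp
  qed
qed

section \<open>Frames: hyperbolic bases of one minor\<close>

lemma supp_inD: "supp_in u R C \<Longrightarrow> p \<notin> R \<or> q \<notin> C \<Longrightarrow> u p q = 0"
  unfolding supp_in_def by blast

text \<open>By \<open>frame_supp\<close> and \<open>hyperbolic_expansion\<close> the four matrices
  form a basis of the matrices supported in the minor, with dual pairs \<open>x, y\<close> and
  \<open>z, w\<close>.\<close>

definition frame where
  "frame x y z w r r' c c' \<longleftrightarrow> r \<noteq> r' \<and> c \<noteq> c' \<and> dual_quad x y z w \<and> pol x y r r' c c' \<noteq> 0"

text \<open>Orthogonality at every minor except one. In \<open>active_supp\<close> the pairings off
  the active minor are known to vanish and the one at it is not; the former already confine the
  support. Comparing sets makes the order of the indices irrelevant.\<close>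

definition perp_off :: "('r \<Rightarrow> 'c \<Rightarrow> 'a::field) \<Rightarrow> ('r \<Rightarrow> 'c \<Rightarrow> 'a) \<Rightarrow> 'r set \<Rightarrow> 'c set \<Rightarrow> bool" where
  "perp_off u v R C \<longleftrightarrow>
    (\<forall>r r' c c'. r \<noteq> r' \<longrightarrow> c \<noteq> c' \<longrightarrow> {r, r'} \<noteq> R \<or> {c, c'} \<noteq> C \<longrightarrow> pol u v r r' c c' = 0)"

lemma perp_imp_perp_off: "perp u v \<Longrightarrow> perp_off u v R C"
  by (simp add: perp_def perp_off_def)

lemma perp_off_tr [simp]: "perp_off (tr u) (tr v) C R \<longleftrightarrow> perp_off u v R C"
  unfolding perp_off_def pol_tr by blast

lemma frame_tr: "frame (tr x) (tr y) (tr z) (tr w) c c' r r' \<longleftrightarrow> frame x y z w r r' c c'"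
  unfolding frame_def pol_tr dual_quad_tr by blast

lemma frame_supp:
  fixes x :: "'r \<Rightarrow> 'c \<Rightarrow> 'a::field"
  assumes "(2::'a) \<noteq> 0" "frame x y z w r r' c c'"
  shows "supp_in x {r, r'} {c, c'}" "supp_in y {r, r'} {c, c'}" "supp_in z {r, r'} {c, c'}" "supp_in w {r, r'} {c, c'}"
  using quad_supp[OF assms(1), of r r' c c' x y z w] assms(2) unfolding frame_def by auto

text \<open>Three of the four coefficients in the dual basis vanish; only that of \<open>x\<close>,
  the partner of \<open>y\<close>, is left.\<close>

lemma frame_expansion:
  assumes f: "frame x y z w r r' c c'" and p: "p \<in> {r, r'}" and q: "q \<in> {c, c'}"
    and u: "pol u x r r' c c' = 0" "pol u z r r' c c' = 0" "pol u w r r' c c' = 0"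
  shows "pol x y r r' c c' * u p q = pol u y r r' c c' * x p q"
proof -
  have *: "pol z w r r' c c' = pol x y r r' c c'" "pol x x r r' c c' = 0" "pol y y r r' c c' = 0"
    "pol z z r r' c c' = 0" "pol w w r r' c c' = 0" "pol x z r r' c c' = 0" "pol x w r r' c c' = 0"
    "pol y z r r' c c' = 0" "pol y w r r' c c' = 0" "pol x y r r' c c' \<noteq> 0"
    using f unfolding frame_def dual_quad_def perp_def by auto
  show ?thesis
    using hyperbolic_expansion[where P = "\<lambda>u v. pol u v r r' c c'", OF refl refl *(1,10,2-9) p q, of u] u
    by simp
qed

lemma frame_perp_off_cols:
  fixes x :: "'r \<Rightarrow> 'c \<Rightarrow> 'a::field"
  assumes two: "(2::'a) \<noteq> 0" and f: "frame x y z w r r' c c'"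
    and u: "\<And>v. v \<in> {x, z, w} \<Longrightarrow> perp_off u v {r, r'} {c, c'}"
    and q: "q \<notin> {c, c'}"
  shows "u r q = 0 \<and> u r' q = 0"
proof -
  define T where "T = pol x y r r' c c'"
  have K: "r \<noteq> r'" "c \<noteq> c'" "T \<noteq> 0" using f by (auto simp: frame_def T_def)
  have z: "v s q = 0" if "v \<in> {x, z, w}" for v s
    using frame_supp[OF two f] that q unfolding supp_in_def by auto
  have 1: "u r' q * v r c + u r q * v r' c = 0" "u r' q * v r c' + u r q * v r' c' = 0"
    if v: "v \<in> {x, z, w}" for v
  proof -
    have "pol u v r r' c q = 0" "pol u v r r' c' q = 0"
      using u[OF v] K q unfolding perp_off_def by (auto simp: doubleton_eq_iff)
    thus "u r' q * v r c + u r q * v r' c = 0" "u r' q * v r c' + u r q * v r' c' = 0"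
      by (auto simp: pol_def z[OF v])
  qed
  txt \<open>
    Pairing \<open>u\<close> with a matrix supported in the minor, but across columns \<open>c, q\<close> (resp. \<open>c', q\<close>), is
    pairing it inside the minor with \<open>g\<close> (resp. \<open>g'\<close>). Hence both are multiples of \<open>x\<close>, although
    they live in different columns.
  \<close>
  define g where "g = (\<lambda>s t. if t = c' then u s q else 0)"
  define g' where "g' = (\<lambda>s t. if t = c then u s q else 0)"
  have g: "pol g v r r' c c' = 0" "pol g' v r r' c c' = 0" if "v \<in> {x, z, w}" for v
    using 1[OF that] K by (simp_all add: pol_def g_def g'_def add.commute)
  obtain k where k: "\<And>s t. s \<in> {r, r'} \<Longrightarrow> t \<in> {c, c'} \<Longrightarrow> T * g s t = k * x s t"
    using frame_expansion[OF f _ _ g(1) g(1) g(1)] unfolding T_def by auto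
  obtain k' where k': "\<And>s t. s \<in> {r, r'} \<Longrightarrow> t \<in> {c, c'} \<Longrightarrow> T * g' s t = k' * x s t"
    using frame_expansion[OF f _ _ g(2) g(2) g(2)] unfolding T_def by auto
  \<comment> \<open>If \<open>k\<close> is nonzero, column \<open>c\<close> of \<open>x\<close>
    vanishes and the equations with \<open>k'\<close> make \<open>u\<close> zero in column
    \<open>q\<close>; if \<open>k = 0\<close>, those with \<open>k\<close> do.\<close>
  have "k * x r c = 0" "k * x r' c = 0" "k' * x r c' = 0" "k' * x r' c' = 0"
    "T * u r q = k * x r c'" "T * u r' q = k * x r' c'" "T * u r q = k' * x r c" "T * u r' q = k' * x r' c"
    using k[of r c] k[of r' c] k[of r c'] k[of r' c'] k'[of r c] k'[of r' c] k'[of r c'] k'[of r' c'] K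
    by (auto simp: g_def g'_def)
  thus ?thesis using K(3) by (metis mult_eq_0_iff)
qed

lemma frame_perp_off_supp:
  fixes x :: "'r \<Rightarrow> 'c \<Rightarrow> 'a::field"
  assumes two: "(2::'a) \<noteq> 0" and f: "frame x y z w r r' c c'"
    and u: "\<And>v. v \<in> {x, z, w} \<Longrightarrow> perp_off u v {r, r'} {c, c'}"
  shows "supp_in u {r, r'} {c, c'}"
proof -
  have K: "r \<noteq> r'" "c \<noteq> c'" using f by (auto simp: frame_def)
  have cols: "u p q = 0" if "p \<in> {r, r'}" "q \<notin> {c, c'}" for p q
    using frame_perp_off_cols[OF two f u that(2)] that(1) by auto
  have rows: "u p q = 0" if "p \<notin> {r, r'}" "q \<in> {c, c'}" for p q
  proof -
    have "perp_off (tr u) v {c, c'} {r, r'}" if "v \<in> {tr x, tr z, tr w}" for v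
      using that u[of x] u[of z] u[of w] by auto
    from frame_perp_off_cols[OF two frame_tr[THEN iffD2, OF f] this that(1)] that(2)
    show ?thesis by (auto simp: tr_def)
  qed
  have out: "u p q = 0" if pq: "p \<notin> {r, r'}" "q \<notin> {c, c'}" for p q
  proof -
    \<comment> \<open>\<open>x\<close> has a nonzero entry in the minor because its pairing with
      \<open>y\<close> is nonzero there. As \<open>x\<close> is confined to the minor, pairing
      across its border isolates \<open>u p q\<close>.\<close>
    have "\<exists>s\<in>{r, r'}. \<exists>t\<in>{c, c'}. x s t \<noteq> 0"
      using f unfolding frame_def pol_def by (rule_tac ccontr) simp
    then obtain s t where st: "s \<in> {r, r'}" "t \<in> {c, c'}" "x s t \<noteq> 0" by blast
    have "pol u x s p t q = 0"
      using u[of x] st pq unfolding perp_off_def by (auto simp: doubleton_eq_iff)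
    moreover have "x p q = 0" "x s q = 0" "x p t = 0"
      using frame_supp(1)[OF two f] pq unfolding supp_in_def by auto
    ultimately show ?thesis using st(3) by (simp add: pol_def)
  qed
  show ?thesis unfolding supp_in_def using cols rows out by blast
qed

lemma frame_perp_multiple:
  fixes x :: "'r \<Rightarrow> 'c \<Rightarrow> 'a::field"
  assumes two: "(2::'a) \<noteq> 0" and f: "frame x y z w r r' c c'"
    and u: "perp u x" "perp u z" "perp u w"
  obtains k where "u = (\<lambda>p q. k * x p q)"
proof
  define T where "T = pol x y r r' c c'"
  have K: "r \<noteq> r'" "c \<noteq> c'" "T \<noteq> 0" using f by (auto simp: frame_def T_def)
  have s: "supp_in u {r, r'} {c, c'}"
    using frame_perp_off_supp[OF two f] u perp_imp_perp_off by blast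
  show "u = (\<lambda>p q. (pol u y r r' c c' / T) * x p q)"
  proof (intro ext)
    fix p q
    show "u p q = pol u y r r' c c' / T * x p q"
    proof (cases "p \<in> {r, r'} \<and> q \<in> {c, c'}")
      case True
      have "T * u p q = pol u y r r' c c' * x p q"
        unfolding T_def using u K True by (intro frame_expansion[OF f]) (auto simp: perp_def)
      thus ?thesis using K by (simp add: field_simps)
    next
      case False
      hence "u p q = 0" "x p q = 0" using s frame_supp(1)[OF two f] unfolding supp_in_def by blast+
      thus ?thesis by simp
    qed
  qed
qed

text \<open>The form on the minor is nondegenerate; this is how \<open>paired_cells\<close> finds a
  second active minor.\<close>

lemma frame_perp_zero:
  fixes x :: "'r \<Rightarrow> 'c \<Rightarrow> 'a::field"
  assumes two: "(2::'a) \<noteq> 0" and f: "frame x y z w r r' c c'"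
    and u: "perp u x" "perp u y" "perp u z" "perp u w"
  shows "u p q = 0"
proof -
  obtain k where k: "u = (\<lambda>p q. k * x p q)" using frame_perp_multiple[OF two f u(1,3,4)] .
  have "pol u y r r' c c' = 0" using u(2) f unfolding perp_def frame_def by blast
  hence "k * pol x y r r' c c' = 0" unfolding k pol_scale_left .
  thus ?thesis using f k unfolding frame_def by auto
qed

text \<open>
  The situation of two active minors sharing the column \<open>c\<close>: the columns of \<open>x1, x2, x3\<close> at \<open>c, c', e\<close>
  are nonzero and pairwise orthogonal in a hyperbolic plane, which is only possible on one isotropic line.
\<close>
lemma cells_core:
  fixes x1 x2 x3 y1 y2 y3 :: "'r \<Rightarrow> 'c \<Rightarrow> 'a::field"
  assumes two: "(2::'a) \<noteq> 0" and r: "r \<noteq> r'" and c: "c \<noteq> c'" "c \<noteq> e" "c' \<noteq> e"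
    and supp: "supp_in x1 {r, r'} {c}" "supp_in y1 {r, r'} {c}"
      "supp_in x2 {r, r'} {c, c'}" "supp_in y2 {r, r'} {c, c'}"
      "supp_in x3 {r, r'} {c, e}" "supp_in y3 {r, r'} {c, e}"
    and perp: "perp x2 x2" "perp x3 x3" "perp y2 y2" "perp y3 y3" "perp x1 x2" "perp x1 x3" "perp x2 x3"
      "perp y1 y2" "perp y1 y3" "perp y2 y3" "perp x2 y2"
    and pol: "pol x1 y2 r r' c c' = pol x2 y1 r r' c c'" "pol x1 y3 r r' c e = pol x3 y1 r r' c e"
      "pol x2 y3 r r' c e = pol x3 y2 r r' c e" "pol x2 y3 r r' c' e = pol x3 y2 r r' c' e"
    and nz: "pol x1 y2 r r' c c' \<noteq> 0" "pol x1 y3 r r' c e \<noteq> 0"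
    and q1: "x1 r' c = 0"
  shows "supp_in x1 {r} {c}" "supp_in x2 {r} {c'}" "supp_in y1 {r'} {c}" "supp_in y2 {r'} {c'}"
proof -
  have z: "x1 r e = 0" "x1 r' e = 0" "y1 r e = 0" "y1 r' e = 0"
    "x1 r c' = 0" "x1 r' c' = 0" "y1 r c' = 0" "y1 r' c' = 0"
    "x2 r e = 0" "x2 r' e = 0" "y2 r e = 0" "y2 r' e = 0"
    "x3 r c' = 0" "x3 r' c' = 0" "y3 r c' = 0" "y3 r' c' = 0"
    using c by (auto intro!: supp[THEN supp_inD])
  have P: "pol u v r r' c c' = 0" "pol u v r r' c e = 0" "pol u v r r' c' e = 0" if "perp u v" for u v :: "'r \<Rightarrow> 'c \<Rightarrow> 'a"
    using that r c unfolding perp_def by blast+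
  have d: "a = 0" if "a * b = - (a * b)" "b \<noteq> 0" for a b :: 'a
    using that two by (metis add.right_inverse mult_2 mult_eq_0_iff)
  have 1: "x1 r c \<noteq> 0" "y2 r' c' \<noteq> 0" "y3 r' e \<noteq> 0"
    using nz q1 by (auto simp: pol_def z)
  have 2: "x2 r' c' = 0" "x3 r' e = 0"
    using P(1)[OF perp(5)] P(2)[OF perp(6)] 1 q1 by (auto simp: pol_def z)
  have 3: "x2 r c' \<noteq> 0" "y1 r' c \<noteq> 0" "x3 r e \<noteq> 0"
    using pol(1,2) nz by (auto simp: pol_def z 2)
  \<comment> \<open>Between any two of \<open>y1, y2, y3\<close> the ratio of the row entries
    changes sign. Round the triangle this gives \<open>t = - t\<close> for the product below, hence
    a zero factor.\<close>
  have yy: "y1 r c * y2 r' c' = - (y1 r' c * y2 r c')" "y1 r c * y3 r' e = - (y1 r' c * y3 r e)"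
     "y2 r c' * y3 r' e = - (y2 r' c' * y3 r e)"
    using P(1)[OF perp(8)] P(2)[OF perp(9)] P(3)[OF perp(10)]
    by (auto simp: pol_def z eq_neg_iff_add_eq_0 algebra_simps)
  have "y1 r c * (y2 r' c' * y3 r' e) = - (y1 r' c * (y2 r c' * y3 r' e))"
    using yy(1) by (simp add: mult.assoc[symmetric])
  also have "\<dots> = y2 r' c' * (y1 r' c * y3 r e)"
    using yy(3) by simp
  also have "\<dots> = - (y1 r c * (y2 r' c' * y3 r' e))"
    using yy(2) by (metis mult.left_commute mult_minus_right add.inverse_inverse)
  finally have 4: "y1 r c = 0" using 1 by (intro d[of "y1 r c" "y2 r' c' * y3 r' e"]) auto
  have 5: "y2 r c' = 0" "y3 r e = 0" using yy 4 3 by auto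
  have 6: "x2 r' c = 0" "x3 r' c = 0" "y2 r c = 0" "y3 r c = 0"
    using P(1)[OF perp(1)] P(2)[OF perp(2)] P(1)[OF perp(3)] P(2)[OF perp(4)] 1 2 3 5 two
    by (auto simp: pol_def z)
  \<comment> \<open>Eliminating \<open>x3\<close> and \<open>y3\<close> through column
    \<open>e\<close> gives \<open>x2 r c * y2 r' c' = x2 r c' * y2 r' c\<close>, with the sign
    opposite to that in the orthogonality of \<open>x2\<close> and \<open>y2\<close>.\<close>
  have 7: "x2 r c * y2 r' c' = - (x2 r c' * y2 r' c)" "x2 r c * y3 r' e = x3 r e * y2 r' c"
     "x2 r c' * y3 r' e = x3 r e * y2 r' c'"
    using P(1)[OF perp(11)] pol(3,4) 6 5 2
    by (auto simp: pol_def z eq_neg_iff_add_eq_0 algebra_simps)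
  have "x2 r c * (y2 r' c' * x3 r e) = x2 r c' * (x2 r c * y3 r' e)"
    using 7(3) by (metis mult.commute mult.left_commute)
  also have "\<dots> = x3 r e * (x2 r c' * y2 r' c)" unfolding 7(2) by (simp add: mult_ac)
  also have "x2 r c' * y2 r' c = - (x2 r c * y2 r' c')" unfolding 7(1) by simp
  also have "x3 r e * - (x2 r c * y2 r' c') = - (x2 r c * (y2 r' c' * x3 r e))" by (simp add: mult_ac)
  finally have 8: "x2 r c = 0" using 1 3 by (intro d[of "x2 r c" "y2 r' c' * x3 r e"]) auto
  hence 9: "y2 r' c = 0" using 7(2) 3 by simp
  show "supp_in x1 {r} {c}" "supp_in x2 {r} {c'}" "supp_in y1 {r'} {c}" "supp_in y2 {r'} {c'}"
    using supp q1 2 4 5 6 8 9 unfolding supp_in_def by auto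
qed

section \<open>Grids of cells\<close>

text \<open>The model: \<open>x j\<close> and \<open>y j\<close> are the images of fixed multiples
  of the units in column \<open>j\<close> of two fixed rows (\<open>paired_rows\<close>). With rows
  and scalars forgotten, only one index varies, and the relations survive transposing the images
  (\<open>paired_tr\<close>).\<close>

definition paired :: "'k set \<Rightarrow> ('k \<Rightarrow> 'r \<Rightarrow> 'c \<Rightarrow> 'a::field) \<Rightarrow> ('k \<Rightarrow> 'r \<Rightarrow> 'c \<Rightarrow> 'a) \<Rightarrow> bool" where
  "paired J x y \<longleftrightarrow> (\<forall>i\<in>J. perp (x i) (y i)) \<and> (\<forall>i\<in>J. \<forall>j\<in>J. perp (x i) (x j) \<and> perp (y i) (y j) \<and>
     (\<forall>r r' c c'. r \<noteq> r' \<longrightarrow> c \<noteq> c' \<longrightarrow> pol (x i) (y j) r r' c c' = pol (x j) (y i) r r' c c'))"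

lemma perpD: "perp u v \<Longrightarrow> r \<noteq> r' \<Longrightarrow> c \<noteq> c' \<Longrightarrow> pol u v r r' c c' = 0"
  by (simp add: perp_def)

lemma paired_pol:
  "paired J x y \<Longrightarrow> i \<in> J \<Longrightarrow> j \<in> J \<Longrightarrow> r \<noteq> r' \<Longrightarrow> c \<noteq> c' \<Longrightarrow>
     pol (x i) (y j) r r' c c' = pol (x j) (y i) r r' c c'"
  by (simp add: paired_def)

lemma paired_tr: "paired J x y \<Longrightarrow> paired J (\<lambda>i. tr (x i)) (\<lambda>i. tr (y i))"
  unfolding paired_def perp_tr pol_tr by blast

lemma paired_dual_quad:
  assumes "paired J x y" "i \<in> J" "j \<in> J"
  shows "dual_quad (x i) (y j) (x j) (y i)"
proof -
  have "perp (y j) (x j)" using assms unfolding paired_def by (metis perp_sym)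
  thus ?thesis using assms unfolding paired_def dual_quad_def by auto
qed

lemma paired_frame:
  assumes "paired J x y" "i \<in> J" "j \<in> J" "r \<noteq> r'" "c \<noteq> c'" "pol (x i) (y j) r r' c c' \<noteq> 0"
  shows "frame (x i) (y j) (x j) (y i) r r' c c'"
  unfolding frame_def using assms paired_dual_quad[OF assms(1-3)] by auto

lemma pol_cong_sets:
  assumes "r \<noteq> r'" "c \<noteq> c'" "{r, r'} = {s, s'}" "{c, c'} = {t, t'}"
  shows "pol u v r r' c c' = pol u v s s' t t'"
  using assms by (auto simp: doubleton_eq_iff pol_swap_rows pol_swap_cols)

text \<open>\<open>xi, xj\<close> share a row and \<open>xi, yi\<close> a column. Exchanging the two
  middle arguments describes the transposed arrangement, so this one notion expresses both outcomes
  of \<open>paired_cells\<close>.\<close>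

definition cell_grid where
  "cell_grid xi xj yi yj \<longleftrightarrow> (\<exists>r r' c c'. r \<noteq> r' \<and> c \<noteq> c' \<and>
     supp_in xi {r} {c} \<and> supp_in xj {r} {c'} \<and> supp_in yi {r'} {c} \<and> supp_in yj {r'} {c'})"

lemma cell_gridI:
  "r \<noteq> r' \<Longrightarrow> c \<noteq> c' \<Longrightarrow> supp_in xi {r} {c} \<Longrightarrow> supp_in xj {r} {c'} \<Longrightarrow> supp_in yi {r'} {c} \<Longrightarrow>
    supp_in yj {r'} {c'} \<Longrightarrow> cell_grid xi xj yi yj"
  unfolding cell_grid_def by blast

lemma cell_gridE:
  assumes "cell_grid xi xj yi yj"
  obtains r r' c c' where "r \<noteq> r'" "c \<noteq> c'" "supp_in xi {r} {c}" "supp_in xj {r} {c'}"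
    "supp_in yi {r'} {c}" "supp_in yj {r'} {c'}"
  using assms unfolding cell_grid_def by blast

lemma cell_grid_trD: "cell_grid (tr a) (tr b) (tr c) (tr d) \<Longrightarrow> cell_grid a c b d"
  by (erule cell_gridE, rule cell_gridI) simp_all

lemma cell_grid_swap: "cell_grid a b c d \<Longrightarrow> cell_grid b a d c"
  by (erule cell_gridE, erule (1) cell_gridI[OF _ not_sym])

lemma cell_grid_swap_rows: "cell_grid a b c d \<Longrightarrow> cell_grid c d a b"
  by (erule cell_gridE, erule cell_gridI[OF not_sym])

text \<open>Two active minors with the same rows and one common column \<open>c\<close> confine
  \<open>x i\<close> and \<open>y i\<close> to column \<open>c\<close>. What
  \<open>cells_core\<close> still needs is that one of the two entries of \<open>x i\<close> is
  zero.\<close>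

lemma paired_cells_cols:
  fixes x y :: "'k \<Rightarrow> 'r \<Rightarrow> 'c \<Rightarrow> 'a::field"
  assumes two: "(2::'a) \<noteq> 0" and xy: "paired J x y" and J: "i \<in> J" "j \<in> J" "l \<in> J"
    and r: "r \<noteq> r'" and c: "c \<noteq> c'" "c \<noteq> e" "c' \<noteq> e"
    and nz: "pol (x i) (y j) r r' c c' \<noteq> 0" "pol (x i) (y l) r r' c e \<noteq> 0"
  shows "cell_grid (x i) (x j) (y i) (y j)"
proof -
  note f1 = paired_frame[OF xy J(1,2) r c(1) nz(1)]
  note f2 = paired_frame[OF xy J(1,3) r c(2) nz(2)]
  note s1 = frame_supp[OF two f1] and s2 = frame_supp[OF two f2]
  have supp: "supp_in (x i) {r, r'} {c}" "supp_in (y i) {r, r'} {c}"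
    using s1(1,4) s2(1,4) c unfolding supp_in_def by blast+
  have perp: "perp (x j) (x j)" "perp (x l) (x l)" "perp (y j) (y j)" "perp (y l) (y l)"
    "perp (x i) (x j)" "perp (x i) (x l)" "perp (x j) (x l)"
    "perp (y i) (y j)" "perp (y i) (y l)" "perp (y j) (y l)" "perp (x j) (y j)"
    using xy J unfolding paired_def by auto
  note pol = paired_pol[OF xy]
  have core: "x i r c = 0 \<or> x i r' c = 0"
  proof (rule ccontr)
    \<comment> \<open>Then the columns of \<open>x j\<close> at \<open>c'\<close> and of
      \<open>x l\<close> at \<open>e\<close> both have the negative of the row ratio of
      \<open>x i\<close>, hence equal ratios, while their own orthogonality demands opposite ones.
      So one of these columns vanishes, and with it a pairing with \<open>y i\<close> that should be
      nonzero.\<close>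
    assume ne: "\<not> ?thesis"
    have z: "x i r c' = 0" "x i r' c' = 0" "x i r e = 0" "x i r' e = 0" "x j r e = 0" "x j r' e = 0"
      "x l r c' = 0" "x l r' c' = 0" "y i r c' = 0" "y i r' c' = 0" "y i r e = 0" "y i r' e = 0"
      using c by (auto intro!: supp[THEN supp_inD] s1(3)[THEN supp_inD] s2(3)[THEN supp_inD])
    have "pol (x i) (x j) r r' c c' = 0" "pol (x i) (x l) r r' c e = 0" "pol (x j) (x l) r r' c' e = 0"
      using perp(5)[THEN perpD, OF r c(1)] perp(6)[THEN perpD, OF r c(2)] perp(7)[THEN perpD, OF r c(3)] .
    hence e: "x i r c * x j r' c' = - (x i r' c * x j r c')" "x i r c * x l r' e = - (x i r' c * x l r e)"
      "x j r c' * x l r' e + x j r' c' * x l r e = 0"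
      by (auto simp: pol_def z eq_neg_iff_add_eq_0 mult.commute add.commute)
    have "x i r c * (x j r c' * x l r' e + x j r' c' * x l r e) =
      x j r c' * (x i r c * x l r' e) + (x i r c * x j r' c') * x l r e" by (simp add: algebra_simps)
    also have "\<dots> = - 2 * x i r' c * (x j r c' * x l r e)" unfolding e(1,2) by (simp add: algebra_simps)
    finally have "x j r c' = 0 \<or> x l r e = 0" using e(3) ne two by simp
    hence "(x j r c' = 0 \<and> x j r' c' = 0) \<or> (x l r e = 0 \<and> x l r' e = 0)" using e ne by auto
    moreover have "pol (x j) (y i) r r' c c' \<noteq> 0" "pol (x l) (y i) r r' c e \<noteq> 0"
      using nz pol[OF J(1,2) r c(1)] pol[OF J(1,3) r c(2)] by auto
    ultimately show False by (auto simp: pol_def z)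
  qed
  have eqs: "pol (x i) (y j) r r' c c' = pol (x j) (y i) r r' c c'" "pol (x i) (y l) r r' c e = pol (x l) (y i) r r' c e"
    "pol (x j) (y l) r r' c e = pol (x l) (y j) r r' c e" "pol (x j) (y l) r r' c' e = pol (x l) (y j) r r' c' e"
    using pol[OF J(1,2) r c(1)] pol[OF J(1,3) r c(2)] pol[OF J(2,3) r c(2)] pol[OF J(2,3) r c(3)] .
  show ?thesis
  proof (cases "x i r' c = 0")
    case True
    note cc = cells_core[OF two r c supp s1(3,2) s2(3,2) perp eqs nz True]
    show ?thesis by (rule cell_gridI[OF r c(1) cc])
  next
    case False
    hence t: "x i r c = 0" using core by auto
    \<comment> \<open>The situation is symmetric in \<open>r\<close> and \<open>r'\<close>;
      exchanging them moves the zero entry to the row where \<open>cells_core\<close> expects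
      it.\<close>
    have sw: "{r, r'} = {r', r}" by auto
    note flip = sw pol_swap_rows[of _ _ r r']
    note cc = cells_core[OF two r[symmetric] c supp[unfolded flip] s1(3,2)[unfolded flip] s2(3,2)[unfolded flip] perp
        eqs[unfolded flip] nz[unfolded flip] t]
    show ?thesis by (rule cell_gridI[OF r[symmetric] c(1) cc])
  qed
qed

text \<open>\<open>x i\<close> and \<open>y i\<close> lie in both active minors. These minors meet
  because \<open>x i\<close> is not zero, and they differ because \<open>x l\<close> leaks out of
  the first. Two common rows or two common columns lead to \<open>paired_cells_cols\<close>; a
  single common cell is contradictory.\<close>

lemma paired_cells_aux:
  fixes x y :: "'k \<Rightarrow> 'r \<Rightarrow> 'c \<Rightarrow> 'a::field"
  assumes two: "(2::'a) \<noteq> 0" and xy: "paired J x y" and J: "i \<in> J" "j \<in> J" "l \<in> J"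
    and K: "r \<noteq> r'" "c \<noteq> c'" "pol (x i) (y j) r r' c c' \<noteq> 0" and out: "\<not> supp_in (x l) {r, r'} {c, c'}"
    and M: "s \<noteq> s'" "t \<noteq> t'" "pol (x i) (y l) s s' t t' \<noteq> 0"
  shows "cell_grid (x i) (x j) (y i) (y j) \<or> cell_grid (x i) (y i) (x j) (y j)"
proof -
  note f1 = paired_frame[OF xy J(1,2) K]
  note f2 = paired_frame[OF xy J(1,3) M]
  note s1 = frame_supp[OF two f1] and s2 = frame_supp[OF two f2]
  have supp: "supp_in (x i) ({r, r'} \<inter> {s, s'}) ({c, c'} \<inter> {t, t'})" "supp_in (y i) ({r, r'} \<inter> {s, s'}) ({c, c'} \<inter> {t, t'})"
    using s1(1,4) s2(1,4) unfolding supp_in_def by blast+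
  have inter: "\<exists>a b b'. {p, p'} = {a, b} \<and> {q, q'} = {a, b'} \<and> a \<noteq> b \<and> a \<noteq> b' \<and> b \<noteq> b'"
    if "p \<noteq> p'" "q \<noteq> q'" "{p, p'} \<inter> {q, q'} \<noteq> {}" "{p, p'} \<noteq> {q, q'}" for p p' q q' :: 'z
    using that by auto
  have ne: "{r, r'} \<inter> {s, s'} \<noteq> {}" "{c, c'} \<inter> {t, t'} \<noteq> {}"
  proof -
    have "x i p q = 0" if "{r, r'} \<inter> {s, s'} = {} \<or> {c, c'} \<inter> {t, t'} = {}" for p q
      using supp_inD[OF supp(1), of p q] that by auto
    hence "pol (x i) (y j) r r' c c' = 0" if "{r, r'} \<inter> {s, s'} = {} \<or> {c, c'} \<inter> {t, t'} = {}"
      using that by (simp add: pol_def)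
    thus "{r, r'} \<inter> {s, s'} \<noteq> {}" "{c, c'} \<inter> {t, t'} \<noteq> {}" using K(3) by argo+
  qed
  consider "{r, r'} = {s, s'}" "{c, c'} = {t, t'}" | "{r, r'} = {s, s'}" "{c, c'} \<noteq> {t, t'}"
    | "{r, r'} \<noteq> {s, s'}" "{c, c'} = {t, t'}" | "{r, r'} \<noteq> {s, s'}" "{c, c'} \<noteq> {t, t'}" by blast
  thus ?thesis
  proof cases
    case 1
    thus ?thesis using s2(3) out by simp
  next
    case 2
    obtain a b b' where ab: "{c, c'} = {a, b}" "{t, t'} = {a, b'}" "a \<noteq> b" "a \<noteq> b'" "b \<noteq> b'"
      using inter[OF K(2) M(2) ne(2) 2(2)] by blast
    have "cell_grid (x i) (x j) (y i) (y j)"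
      using K(3) M(3) pol_cong_sets[OF K(1,2) refl ab(1), of "x i" "y j"] pol_cong_sets[OF M(1,2) 2(1)[symmetric] ab(2), of "x i" "y l"]
      by (intro paired_cells_cols[OF two xy J K(1) ab(3-5)]) auto
    thus ?thesis ..
  next
    case 3
    obtain a b b' where ab: "{r, r'} = {a, b}" "{s, s'} = {a, b'}" "a \<noteq> b" "a \<noteq> b'" "b \<noteq> b'"
      using inter[OF K(1) M(1) ne(1) 3(1)] by blast
    have "cell_grid (tr (x i)) (tr (x j)) (tr (y i)) (tr (y j))"
      using K(3) M(3) pol_cong_sets[OF K(1,2) ab(1) refl, of "x i" "y j"] pol_cong_sets[OF M(1,2) ab(2) 3(2)[symmetric], of "x i" "y l"]
      by (intro paired_cells_cols[OF two paired_tr[OF xy] J K(2) ab(3-5)]) (auto simp: pol_tr)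
    from cell_grid_trD[OF this] show ?thesis ..
  next
    case 4
    obtain a b b' where ab: "{r, r'} = {a, b}" "{s, s'} = {a, b'}" "a \<noteq> b" "a \<noteq> b'" "b \<noteq> b'"
      using inter[OF K(1) M(1) ne(1) 4(1)] by blast
    obtain p q q' where pq: "{c, c'} = {p, q}" "{t, t'} = {p, q'}" "p \<noteq> q" "p \<noteq> q'" "q \<noteq> q'"
      using inter[OF K(2) M(2) ne(2) 4(2)] by blast
    have eq: "pol u v r r' c c' = pol u v a b p q" for u v :: "'r \<Rightarrow> 'c \<Rightarrow> 'a"
      using pol_cong_sets[OF K(1,2) ab(1) pq(1)] .
    have "{r, r'} \<inter> {s, s'} = {a}" "{c, c'} \<inter> {t, t'} = {p}" using ab pq by auto
    note supp = supp[unfolded this]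
    have z: "x i a q = 0" "x i b p = 0" "x i b q = 0" "y i a q = 0" "y i b p = 0" "y i b q = 0"
      using ab pq by (auto intro!: supp[THEN supp_inD])
    \<comment> \<open>\<open>x i\<close> and \<open>y i\<close> sit in the same cell. Orthogonality
      of \<open>x i\<close> and \<open>x j\<close> makes \<open>x j b q\<close> zero, but this entry
      carries the pairing of \<open>x j\<close> with \<open>y i\<close>, which equals the nonzero
      one of \<open>x i\<close> with \<open>y j\<close>.\<close>
    have "pol (x i) (y j) a b p q = pol (x j) (y i) a b p q" "pol (x i) (x j) a b p q = 0"
      using paired_pol[OF xy J(1,2) ab(3) pq(3)] xy J ab(3) pq(3) by (auto simp: paired_def intro: perpD)
    hence False using K(3) unfolding eq by (auto simp: pol_def z)
    thus ?thesis ..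
  qed
qed

lemma paired_cells:
  fixes x y :: "'k \<Rightarrow> 'r \<Rightarrow> 'c \<Rightarrow> 'a::field"
  assumes two: "(2::'a) \<noteq> 0" and xy: "paired J x y" and J: "i \<in> J" "j \<in> J" "l \<in> J"
    and K: "r \<noteq> r'" "c \<noteq> c'" "pol (x i) (y j) r r' c c' \<noteq> 0" and out: "\<not> supp_in (x l) {r, r'} {c, c'}"
  shows "cell_grid (x i) (x j) (y i) (y j) \<or> cell_grid (x i) (y i) (x j) (y j)"
proof -
  \<comment> \<open>\<open>x l\<close> is orthogonal to \<open>x i\<close> and \<open>x j\<close> in
    any case. Were it orthogonal to \<open>y i\<close> and \<open>y j\<close> too, it would vanish;
    so it pairs with one of them at some minor.\<close>
  have "\<not> (perp (x l) (y i) \<and> perp (x l) (y j))"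
  proof
    assume "perp (x l) (y i) \<and> perp (x l) (y j)"
    hence "x l p q = 0" for p q
      using xy J by (intro frame_perp_zero[OF two paired_frame[OF xy J(1,2) K]]) (auto simp: paired_def)
    thus False using out unfolding supp_in_def by auto
  qed
  then obtain m s s' t t' where m: "m = i \<or> m = j" and s: "s \<noteq> s'" "t \<noteq> t'" "pol (x l) (y m) s s' t t' \<noteq> 0"
    unfolding perp_def by blast
  note pol = paired_pol[OF xy]
  from m show ?thesis
  proof
    assume "m = i"
    thus ?thesis using s pol[OF J(3,1) s(1,2)] by (intro paired_cells_aux[OF two xy J K out s(1,2)]) auto
  next
    assume m: "m = j"
    have "pol (x j) (y i) r r' c c' \<noteq> 0" "pol (x j) (y l) s s' t t' \<noteq> 0"
      using s pol[OF J(3,2) s(1,2)] K(3) pol[OF J(1,2) K(1,2)] m by auto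
    hence "cell_grid (x j) (x i) (y j) (y i) \<or> cell_grid (x j) (y j) (x i) (y i)"
      by (intro paired_cells_aux[OF two xy J(2,1,3) K(1,2) _ out s(1,2)])
    thus ?thesis using cell_grid_swap cell_grid_swap_rows by blast
  qed
qed

section \<open>Images of the scaled matrix units\<close>

lemma supp_in_perp_off:
  assumes "supp_in u {r, r'} {c, c'}" "supp_in v {r, r'} {c, c'}"
  shows "perp_off u v {r, r'} {c, c'}"
  unfolding perp_off_def
proof (intro allI impI)
  fix s s' t t' assume st: "s \<noteq> s'" "t \<noteq> t'" "{s, s'} \<noteq> {r, r'} \<or> {t, t'} \<noteq> {c, c'}"
  have "s \<notin> {r, r'} \<or> s' \<notin> {r, r'} \<or> t \<notin> {c, c'} \<or> t' \<notin> {c, c'}"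
    using st by auto
  thus "pol u v s s' t t' = 0"
    using assms[THEN supp_inD] unfolding pol_def by (elim disjE) simp_all
qed

lemma supp_in_scale: "supp_in u R C \<Longrightarrow> supp_in (\<lambda>p q. k * u p q) R C"
  unfolding supp_in_def by auto

text \<open>An entry of \<open>u\<close> off row \<open>r\<close> is read off by pairing with
  whichever of the two cells is not in its column.\<close>

lemma perp_cells_row:
  assumes "supp_in x {r} {c}" "x r c \<noteq> 0" "supp_in y {r} {c'}" "y r c' \<noteq> 0" "c \<noteq> c'"
    and "perp u x" "perp u y"
  shows "supp_in u {r} UNIV"
proof -
  have "u p q = 0" if "p \<noteq> r" for p q
  proof (cases "q = c")
    case True
    have "pol u y p r q c' = 0" using assms(5) that True by (intro perpD[OF assms(7)]) auto
    moreover have "y p q = 0" "y p c' = 0" "y r q = 0"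
      using that True assms(5) by (auto intro!: supp_inD[OF assms(3)])
    ultimately show ?thesis using assms(4) by (simp add: pol_def)
  next
    case False
    have "pol u x p r q c = 0" using that False by (intro perpD[OF assms(6)]) auto
    moreover have "x p q = 0" "x p c = 0" "x r q = 0"
      using that False by (auto intro!: supp_inD[OF assms(1)])
    ultimately show ?thesis using assms(2) by (simp add: pol_def)
  qed
  thus ?thesis unfolding supp_in_def by auto
qed

text \<open>Units and positions in the images have index types of their own, so that transposing
  either side (\<open>transpose_in\<close>, \<open>transpose_out\<close>) gives another instance.
  Results on rows thus carry over to columns, and \<open>cells_transposed\<close> reduces to
  \<open>cells\<close>.\<close>

locale perp_family =
  fixes I :: "'i set" and J :: "'j set" and \<phi> :: "'i \<Rightarrow> 'j \<Rightarrow> 'a::field \<Rightarrow> 'r \<Rightarrow> 'c \<Rightarrow> 'a"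
  assumes two: "(2::'a) \<noteq> 0"
    and add: "i \<in> I \<Longrightarrow> j \<in> J \<Longrightarrow> \<phi> i j (a + b) p q = \<phi> i j a p q + \<phi> i j b p q"
    and nonzero: "i \<in> I \<Longrightarrow> j \<in> J \<Longrightarrow> a \<noteq> 0 \<Longrightarrow> \<exists>p q. \<phi> i j a p q \<noteq> 0"
    and row: "i \<in> I \<Longrightarrow> j \<in> J \<Longrightarrow> l \<in> J \<Longrightarrow> perp (\<phi> i j a) (\<phi> i l b)"
    and col: "i \<in> I \<Longrightarrow> k \<in> I \<Longrightarrow> j \<in> J \<Longrightarrow> perp (\<phi> i j a) (\<phi> k j b)"
    and block: "i \<in> I \<Longrightarrow> k \<in> I \<Longrightarrow> j \<in> J \<Longrightarrow> l \<in> J \<Longrightarrow> i \<noteq> k \<Longrightarrow> j \<noteq> l \<Longrightarrow> a * d = b * c \<Longrightarrow>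
      s \<noteq> s' \<Longrightarrow> t \<noteq> t' \<Longrightarrow> pol (\<phi> i j a) (\<phi> k l d) s s' t t' = pol (\<phi> i l b) (\<phi> k j c) s s' t t'"
begin

lemma transpose_in: "perp_family J I (\<lambda>j i. \<phi> i j)"
proof
  fix j l i k and s s' :: 'r and t t' :: 'c and a b c d :: 'a
  assume *: "j \<in> J" "l \<in> J" "i \<in> I" "k \<in> I" "j \<noteq> l" "i \<noteq> k" "a * d = b * c" "s \<noteq> s'" "t \<noteq> t'"
  show "pol (\<phi> i j a) (\<phi> k l d) s s' t t' = pol (\<phi> k j b) (\<phi> i l c) s s' t t'"
    using block[of i k j l a d c b s s' t t'] * by (simp add: pol_sym[of "\<phi> k j b"] mult.commute)
qed (simp_all add: two add nonzero row col)

lemma transpose_out: "perp_family I J (\<lambda>i j a. tr (\<phi> i j a))"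
proof
  fix i j p q and a b :: 'a assume ij: "i \<in> I" "j \<in> J"
  show "tr (\<phi> i j (a + b)) p q = tr (\<phi> i j a) p q + tr (\<phi> i j b) p q"
    unfolding tr_def using add[OF ij] .
  assume "a \<noteq> 0"
  thus "\<exists>p q. tr (\<phi> i j a) p q \<noteq> 0" using nonzero[OF ij] unfolding tr_def by blast
next
  fix i j k l and s s' :: 'c and t t' :: 'r and a b c d :: 'a
  assume "i \<in> I" "k \<in> I" "j \<in> J" "l \<in> J" "i \<noteq> k" "j \<noteq> l" "a * d = b * c" "s \<noteq> s'" "t \<noteq> t'"
  thus "pol (tr (\<phi> i j a)) (tr (\<phi> k l d)) s s' t t' = pol (tr (\<phi> i l b)) (tr (\<phi> k j c)) s s' t t'"
    unfolding pol_tr by (intro block)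
qed (simp_all add: two row col)

lemma zero:
  assumes "i \<in> I" "j \<in> J"
  shows "\<phi> i j 0 p q = 0"
proof -
  have "\<phi> i j 0 p q = \<phi> i j 0 p q + \<phi> i j 0 p q"
    using add[OF assms, of 0 0 p q] unfolding add_0_right .
  thus ?thesis by (metis add_cancel_right_right)
qed

lemma exchange:
  assumes "i \<in> I" "k \<in> I" "j \<in> J" "l \<in> J" "a * d = b * c" "s \<noteq> s'" "t \<noteq> t'"
  shows "pol (\<phi> i j a) (\<phi> k l d) s s' t t' = pol (\<phi> i l b) (\<phi> k j c) s s' t t'"
proof -
  consider "i = k" | "j = l" | "i \<noteq> k" "j \<noteq> l" by blast
  thus ?thesis
  proof cases
    case 1
    thus ?thesis using assms row[THEN perpD] by simp
  next
    case 2
    thus ?thesis using assms col[THEN perpD] by simp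
  next
    case 3
    show ?thesis by (rule block[OF assms(1-4) 3 assms(5-7)])
  qed
qed

lemma paired_rows: "i \<in> I \<Longrightarrow> k \<in> I \<Longrightarrow> paired J (\<lambda>j. \<phi> i j a) (\<lambda>j. \<phi> k j d)"
  unfolding paired_def using row col by (auto intro!: exchange)

lemma active_frame:
  assumes "i \<in> I" "k \<in> I" "j \<in> J" "l \<in> J" "r \<noteq> r'" "c \<noteq> c'" "pol (\<phi> i j a) (\<phi> k l d) r r' c c' \<noteq> 0" "a * d = b * e"
  shows "frame (\<phi> i j a) (\<phi> k l d) (\<phi> i l b) (\<phi> k j e) r r' c c'"
proof -
  have "perp (\<phi> k l d) (\<phi> i l b)" "perp (\<phi> k l d) (\<phi> k j e)" using assms row col by auto
  thus ?thesis unfolding frame_def dual_quad_def using assms by (auto intro: row col exchange)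
qed

text \<open>This makes up for the missing homogeneity: all multiples of the unit at
  \<open>i, j\<close> have proportional images.\<close>

lemma active_multiple:
  assumes "i \<in> I" "k \<in> I" "j \<in> J" "l \<in> J" "r \<noteq> r'" "c \<noteq> c'" "pol (\<phi> i j a) (\<phi> k l d) r r' c c' \<noteq> 0"
  obtains m where "\<phi> i j a' = (\<lambda>p q. m * \<phi> i j a p q)"
proof -
  \<comment> \<open>Any two scalars with product \<open>a * d\<close> complete the frame;
    \<open>a * d\<close> and \<open>1\<close> are the simplest.\<close>
  have f: "frame (\<phi> i j a) (\<phi> k l d) (\<phi> i l (a * d)) (\<phi> k j 1) r r' c c'"
    by (rule active_frame[OF assms]) simp
  have "perp (\<phi> i j a') (\<phi> i j a)" "perp (\<phi> i j a') (\<phi> i l (a * d))" "perp (\<phi> i j a') (\<phi> k j 1)"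
    using assms(1-4) row col by auto
  from frame_perp_multiple[OF two f this] that show ?thesis by blast
qed

lemma active_any:
  assumes "i \<in> I" "k \<in> I" "j \<in> J" "l \<in> J" "r \<noteq> r'" "c \<noteq> c'" "pol (\<phi> i j a) (\<phi> k l d) r r' c c' \<noteq> 0"
    and "a' \<noteq> 0" "d' \<noteq> 0"
  shows "pol (\<phi> i j a') (\<phi> k l d') r r' c c' \<noteq> 0"
proof -
  have step: "pol (\<phi> i j a') (\<phi> k l d) r r' c c' \<noteq> 0"
    if h: "i \<in> I" "k \<in> I" "j \<in> J" "l \<in> J" "pol (\<phi> i j a) (\<phi> k l d) r r' c c' \<noteq> 0" "a' \<noteq> 0" for i j k l a d a'
  proof -
    obtain m where m: "\<phi> i j a' = (\<lambda>p q. m * \<phi> i j a p q)"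
      using active_multiple[OF h(1-4) assms(5,6) h(5)] .
    have "m \<noteq> 0" using nonzero[OF h(1,3,6)] unfolding m by auto
    thus ?thesis using h(5) unfolding m pol_scale_left by simp
  qed
  have "pol (\<phi> i j a') (\<phi> k l d) r r' c c' \<noteq> 0" using step assms by blast
  hence "pol (\<phi> k l d) (\<phi> i j a') r r' c c' \<noteq> 0" by (simp add: pol_sym)
  hence "pol (\<phi> k l d') (\<phi> i j a') r r' c c' \<noteq> 0" using step assms by blast
  thus ?thesis by (simp add: pol_sym)
qed

lemma active_supp_any:
  assumes "i \<in> I" "k \<in> I" "j \<in> J" "l \<in> J" "r \<noteq> r'" "c \<noteq> c'" "pol (\<phi> i j a) (\<phi> k l d) r r' c c' \<noteq> 0"
    and "supp_in (\<phi> i j a) R C"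
  shows "supp_in (\<phi> i j a') R C"
  using active_multiple[OF assms(1-7), of a'] supp_in_scale[OF assms(8)] by metis

text \<open>By \<open>activeI\<close> a single nonzero pairing decides this for all nonzero scalars
  and for both diagonals of the block of units.\<close>

definition active where
  "active i k j l r r' c c' \<longleftrightarrow> r \<noteq> r' \<and> c \<noteq> c' \<and>
    (\<forall>a d. a \<noteq> 0 \<longrightarrow> d \<noteq> 0 \<longrightarrow> pol (\<phi> i j a) (\<phi> k l d) r r' c c' \<noteq> 0 \<and> pol (\<phi> i l a) (\<phi> k j d) r r' c c' \<noteq> 0)"

lemma activeI:
  assumes "i \<in> I" "k \<in> I" "j \<in> J" "l \<in> J" "r \<noteq> r'" "c \<noteq> c'" "pol (\<phi> i j a) (\<phi> k l d) r r' c c' \<noteq> 0"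
  shows "active i k j l r r' c c'"
proof -
  have 1: "pol (\<phi> i j 1) (\<phi> k l 1) r r' c c' \<noteq> 0" using active_any[OF assms] by simp
  moreover have "pol (\<phi> i j 1) (\<phi> k l 1) r r' c c' = pol (\<phi> i l 1) (\<phi> k j 1) r r' c c'"
    using assms by (intro exchange) auto
  ultimately have 2: "pol (\<phi> i l 1) (\<phi> k j 1) r r' c c' \<noteq> 0" by simp
  show ?thesis unfolding active_def
    using active_any[OF assms(1-6) 1] active_any[OF assms(1,2,4,3,5,6) 2] assms(5,6) by blast
qed

lemma activeD:
  assumes "active i k j l r r' c c'" "a \<noteq> 0" "d \<noteq> 0"
  shows "pol (\<phi> i j a) (\<phi> k l d) r r' c c' \<noteq> 0" "pol (\<phi> i l a) (\<phi> k j d) r r' c c' \<noteq> 0"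
    "pol (\<phi> k l d) (\<phi> i j a) r r' c c' \<noteq> 0" "pol (\<phi> k j d) (\<phi> i l a) r r' c c' \<noteq> 0"
  using assms unfolding active_def by (simp_all add: pol_sym)

text \<open>Unlike in \<open>cell_grid\<close>, one choice of positions serves all scalars;
  \<open>active_multiple\<close> makes this attainable.\<close>

definition cells where
  "cells i k j l \<longleftrightarrow> (\<exists>r r' c c'. r \<noteq> r' \<and> c \<noteq> c' \<and> (\<forall>a. supp_in (\<phi> i j a) {r} {c} \<and>
     supp_in (\<phi> i l a) {r} {c'} \<and> supp_in (\<phi> k j a) {r'} {c} \<and> supp_in (\<phi> k l a) {r'} {c'}))"

definition cells_transposed where
  "cells_transposed i k j l \<longleftrightarrow> (\<exists>r r' c c'. r \<noteq> r' \<and> c \<noteq> c' \<and> (\<forall>a. supp_in (\<phi> i j a) {r} {c} \<and>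
     supp_in (\<phi> i l a) {r'} {c} \<and> supp_in (\<phi> k j a) {r} {c'} \<and> supp_in (\<phi> k l a) {r'} {c'}))"

lemma cellsI:
  assumes "r \<noteq> r'" "c \<noteq> c'" "\<And>a. supp_in (\<phi> i j a) {r} {c}" "\<And>a. supp_in (\<phi> i l a) {r} {c'}"
    "\<And>a. supp_in (\<phi> k j a) {r'} {c}" "\<And>a. supp_in (\<phi> k l a) {r'} {c'}"
  shows "cells i k j l"
  unfolding cells_def
  by (rule exI[of _ r], rule exI[of _ r'], rule exI[of _ c], rule exI[of _ c']) (simp add: assms)

lemma cells_transposedI:
  assumes "r \<noteq> r'" "c \<noteq> c'" "\<And>a. supp_in (\<phi> i j a) {r} {c}" "\<And>a. supp_in (\<phi> i l a) {r'} {c}"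
    "\<And>a. supp_in (\<phi> k j a) {r} {c'}" "\<And>a. supp_in (\<phi> k l a) {r'} {c'}"
  shows "cells_transposed i k j l"
  unfolding cells_transposed_def
  by (rule exI[of _ r], rule exI[of _ r'], rule exI[of _ c], rule exI[of _ c']) (simp add: assms)

lemma active_cells:
  assumes ijkl: "i \<in> I" "k \<in> I" "j \<in> J" "l \<in> J" and act: "active i k j l r r' c c'"
    and m: "m \<in> J" and out: "\<not> supp_in (\<phi> i m b) {r, r'} {c, c'}"
  shows "cells i k j l \<or> cells_transposed i k j l"
proof -
  have K: "r \<noteq> r'" "c \<noteq> c'" using act by (auto simp: active_def)
  have b: "b \<noteq> 0"
  proof
    assume "b = 0"
    hence "\<phi> i m b p q = 0" for p q using zero[OF ijkl(1) m] by simp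
    thus False using out unfolding supp_in_def by simp
  qed
  have ex: "supp_in (\<phi> i j a) R C" if "supp_in (\<phi> i j b) R C" for R C a
    using active_supp_any[OF ijkl K activeD(1)[OF act b one_neq_zero] that] .
  have ex2: "supp_in (\<phi> i l a) R C" if "supp_in (\<phi> i l b) R C" for R C a
    using active_supp_any[OF ijkl(1,2,4,3) K activeD(2)[OF act b one_neq_zero] that] .
  have ex3: "supp_in (\<phi> k l a) R C" if "supp_in (\<phi> k l 1) R C" for R C a
    using active_supp_any[OF ijkl(2,1,4,3) K activeD(3)[OF act one_neq_zero one_neq_zero] that] .
  have ex4: "supp_in (\<phi> k j a) R C" if "supp_in (\<phi> k j 1) R C" for R C a
    using active_supp_any[OF ijkl(2,1,3,4) K activeD(4)[OF act one_neq_zero one_neq_zero] that] .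
  \<comment> \<open>Row \<open>i\<close> is taken with the scalar \<open>b\<close>, so that the
    leaking image \<open>\<phi> i m b\<close> belongs to the paired family. The facts
    \<open>ex\<close> to \<open>ex4\<close> carry the cells over to all scalars.\<close>
  have "cell_grid (\<phi> i j b) (\<phi> i l b) (\<phi> k j 1) (\<phi> k l 1) \<or> cell_grid (\<phi> i j b) (\<phi> k j 1) (\<phi> i l b) (\<phi> k l 1)"
    using paired_cells[OF two paired_rows[OF ijkl(1,2), of b 1] ijkl(3,4) m K activeD(1)[OF act b one_neq_zero] out] .
  thus ?thesis
  proof
    assume "cell_grid (\<phi> i j b) (\<phi> i l b) (\<phi> k j 1) (\<phi> k l 1)"
    then obtain r r' c c' where rc: "r \<noteq> r'" "c \<noteq> c'" "supp_in (\<phi> i j b) {r} {c}" "supp_in (\<phi> i l b) {r} {c'}"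
      "supp_in (\<phi> k j 1) {r'} {c}" "supp_in (\<phi> k l 1) {r'} {c'}" by (elim cell_gridE)
    have "cells i k j l" by (rule cellsI[OF rc(1,2) ex[OF rc(3)] ex2[OF rc(4)] ex4[OF rc(5)] ex3[OF rc(6)]])
    thus ?thesis ..
  next
    assume "cell_grid (\<phi> i j b) (\<phi> k j 1) (\<phi> i l b) (\<phi> k l 1)"
    then obtain r r' c c' where rc: "r \<noteq> r'" "c \<noteq> c'" "supp_in (\<phi> i j b) {r} {c}" "supp_in (\<phi> k j 1) {r} {c'}"
      "supp_in (\<phi> i l b) {r'} {c}" "supp_in (\<phi> k l 1) {r'} {c'}" by (elim cell_gridE)
    have "cells_transposed i k j l" by (rule cells_transposedI[OF rc(1,2) ex[OF rc(3)] ex2[OF rc(5)] ex4[OF rc(4)] ex3[OF rc(6)]])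
    thus ?thesis ..
  qed
qed

text \<open>\<open>exchange\<close> turns the pairing of \<open>\<phi> m n a\<close> with a frame
  member into one between an image from column \<open>j\<close> or \<open>l\<close> and one from row
  \<open>i\<close> or \<open>k\<close>. Both live in the active minor, so the pairing vanishes at
  every other minor.\<close>

lemma active_supp:
  assumes ijkl: "i \<in> I" "k \<in> I" "j \<in> J" "l \<in> J" and act: "active i k j l r r' c c'"
    and rows: "\<And>m a. m \<in> J \<Longrightarrow> supp_in (\<phi> i m a) {r, r'} {c, c'} \<and> supp_in (\<phi> k m a) {r, r'} {c, c'}"
    and cols: "\<And>m a. m \<in> I \<Longrightarrow> supp_in (\<phi> m j a) {r, r'} {c, c'} \<and> supp_in (\<phi> m l a) {r, r'} {c, c'}"
    and mn: "m \<in> I" "n \<in> J"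
  shows "supp_in (\<phi> m n a) {r, r'} {c, c'}"
proof -
  have K: "r \<noteq> r'" "c \<noteq> c'" using act by (auto simp: active_def)
  have f: "frame (\<phi> i j 1) (\<phi> k l 1) (\<phi> i l 1) (\<phi> k j 1) r r' c c'"
    by (rule active_frame[OF ijkl K activeD(1)[OF act]]) simp_all
  have "perp_off (\<phi> m n a) (\<phi> i' j' 1) {r, r'} {c, c'}" if ij: "i' \<in> {i, k}" "j' \<in> {j, l}" for i' j'
  proof -
    have "perp_off (\<phi> m j' a) (\<phi> i' n 1) {r, r'} {c, c'}"
      using ij rows[OF mn(2)] cols[OF mn(1)] by (intro supp_in_perp_off) auto
    moreover have "pol (\<phi> m n a) (\<phi> i' j' 1) s s' t t' = pol (\<phi> m j' a) (\<phi> i' n 1) s s' t t'"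
      if "s \<noteq> s'" "t \<noteq> t'" for s s' t t'
      using ij ijkl mn that by (intro exchange) auto
    ultimately show ?thesis unfolding perp_off_def by simp
  qed
  thus ?thesis by (intro frame_perp_off_supp[OF two f]) auto
qed

end

section \<open>Isotropic groups and product structure of the scalars\<close>

lemma pol_self: "pol x x r r' c c' = 2 * (x r c * x r' c' + x r c' * x r' c)"
  by (simp add: pol_def algebra_simps)

lemma pol_self_eq_0:
  fixes x :: "'r \<Rightarrow> 'c \<Rightarrow> 'a::field"
  assumes "(2::'a) \<noteq> 0"
  shows "pol x x r r' c c' = 0 \<longleftrightarrow> x r c * x r' c' + x r c' * x r' c = 0"
  using assms unfolding pol_self mult_eq_0_iff by simp

text \<open>In a column \<open>q\<close> outside, orthogonality to \<open>x\<close> gives two linear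
  equations for \<open>u r q\<close> and \<open>u r' q\<close>. Up to sign their determinant is that
  of the minor of \<open>x\<close>, which is \<open>2 * (x r c * x r' c')\<close> because the
  permanent of the minor vanishes.\<close>

lemma isotropic_supp:
  fixes x u :: "'r \<Rightarrow> 'c \<Rightarrow> 'a::field"
  assumes two: "(2::'a) \<noteq> 0" and K: "r \<noteq> r'" "c \<noteq> c'" "x r c \<noteq> 0" "x r' c' \<noteq> 0"
    and perp: "perp x x" "perp u x"
  shows "supp_in u {r, r'} {c, c'}"
proof -
  have cols: "u r q = 0 \<and> u r' q = 0"
    if K: "r \<noteq> r'" "c \<noteq> c'" "x r c \<noteq> 0" "x r' c' \<noteq> 0" "q \<notin> {c, c'}" and perp: "perp x x" "perp u x"
      and u: "u = x \<or> (x r q = 0 \<and> x r' q = 0)"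
    for x u :: "'s \<Rightarrow> 't \<Rightarrow> 'a" and r r' c c' q
  proof -
    have d: "x r c * x r' c' + x r c' * x r' c = 0"
      using perpD[OF perp(1) K(1,2)] two by (simp add: pol_self_eq_0[OF two])
    have 1: "pol u x r r' c q = 0" "pol u x r r' c' q = 0"
      using K(5) by (auto intro!: perpD[OF perp(2) K(1)])
    have "x r c * u r' q + x r' c * u r q = 0 \<and> x r c' * u r' q + x r' c' * u r q = 0"
      using u
    proof
      assume "u = x"
      thus "x r c * u r' q + x r' c * u r q = 0 \<and> x r c' * u r' q + x r' c' * u r q = 0"
        using 1 two by (simp_all add: pol_self_eq_0[OF two] algebra_simps)
    next
      assume "x r q = 0 \<and> x r' q = 0"
      thus "x r c * u r' q + x r' c * u r q = 0 \<and> x r c' * u r' q + x r' c' * u r q = 0"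
        using 1 by (simp_all add: pol_def algebra_simps)
    qed
    hence 2: "x r c * u r' q + x r' c * u r q = 0" "x r c' * u r' q + x r' c' * u r q = 0" by auto
    have "2 * (x r c * x r' c') * u r q =
        x r c * (x r c' * u r' q + x r' c' * u r q) - x r c' * (x r c * u r' q + x r' c * u r q)
        + (x r c * x r' c' + x r c' * x r' c) * u r q"
      by (simp add: algebra_simps)
    hence "u r q = 0" unfolding 2 d using two K by simp
    thus ?thesis using 2(1) K by simp
  qed
  \<comment> \<open>Used with \<open>u = x\<close> first; once \<open>x\<close> is confined to the
    minor, the second alternative covers every other \<open>u\<close>.\<close>
  have supp: "supp_in u {r, r'} {c, c'}"
    if perp: "perp u x" and u: "u = x \<or> supp_in x {r, r'} {c, c'}" for u
  proof -
    have 1: "u r q = 0 \<and> u r' q = 0" if "q \<notin> {c, c'}" for q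
      using u that by (intro cols[OF K that assms(6) perp]) (auto dest: supp_inD)
    have 2: "u p c = 0 \<and> u p c' = 0" if "p \<notin> {r, r'}" for p
    proof -
      have "tr u = tr x \<or> (tr x c p = 0 \<and> tr x c' p = 0)"
        using u that by (auto dest: supp_inD simp: tr_def)
      hence "tr u c p = 0 \<and> tr u c' p = 0"
        using that K by (intro cols[of c c' r r' "tr x"]) (simp_all add: assms(6) perp, simp_all add: tr_def)
      thus ?thesis by (simp add: tr_def)
    qed
    have 3: "u p q = 0" if pq: "p \<notin> {r, r'}" "q \<notin> {c, c'}" for p q
    proof -
      have "pol u x p r q c = 0" using pq by (intro perpD[OF perp]) auto
      moreover have uz: "u p c = 0" "u r q = 0" using 1[OF pq(2)] 2[OF pq(1)] by auto
      ultimately show ?thesis using u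
      proof (elim disjE)
        assume "u = x"
        thus ?thesis using \<open>pol u x p r q c = 0\<close> K(3) two uz by (simp add: pol_self_eq_0[OF two])
      next
        assume "supp_in x {r, r'} {c, c'}"
        hence "x p q = 0" "x p c = 0" "x r q = 0" using pq by (auto dest: supp_inD)
        thus ?thesis using \<open>pol u x p r q c = 0\<close> K(3) by (simp add: pol_def)
      qed
    qed
    show ?thesis unfolding supp_in_def
    proof (intro allI impI, rule ccontr)
      fix p q assume "u p q \<noteq> 0" "\<not> (p \<in> {r, r'} \<and> q \<in> {c, c'})"
      thus False using 1[of q] 2[of p] 3[of p q] by auto
    qed
  qed
  show ?thesis using supp[OF perp(2)] supp[OF perp(1)] by blast
qed

text \<open>If no member has two nonzero entries in general position, closure under addition
  decides: a member with two nonzero entries in one line and a member leaving that line would have a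
  sum with such entries.\<close>

lemma isotropic_group:
  fixes G :: "('r \<Rightarrow> 'c \<Rightarrow> 'a::field) set"
  assumes two: "(2::'a) \<noteq> 0"
    and add: "\<And>u v. u \<in> G \<Longrightarrow> v \<in> G \<Longrightarrow> (\<lambda>p q. u p q + v p q) \<in> G"
    and perp: "\<And>u v. u \<in> G \<Longrightarrow> v \<in> G \<Longrightarrow> perp u v"
  shows "(\<exists>r. \<forall>u\<in>G. supp_in u {r} UNIV) \<or> (\<exists>c. \<forall>u\<in>G. supp_in u UNIV {c}) \<or>
     (\<exists>r r' c c'. \<forall>u\<in>G. supp_in u {r, r'} {c, c'})"
proof (cases "\<exists>x\<in>G. \<exists>r r' c c'. r \<noteq> r' \<and> c \<noteq> c' \<and> x r c \<noteq> 0 \<and> x r' c' \<noteq> 0")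
  case True
  then obtain x r r' c c' where x: "x \<in> G" "r \<noteq> r'" "c \<noteq> c'" "x r c \<noteq> 0" "x r' c' \<noteq> 0" by blast
  have "\<forall>u\<in>G. supp_in u {r, r'} {c, c'}"
    using isotropic_supp[OF two x(2-5)] perp x(1) by blast
  thus ?thesis by blast
next
  case False
  \<comment> \<open>The set and the index types are local to this claim because it is also applied
    to the transposes of the members.\<close>
  have row: "\<forall>y\<in>G. supp_in y {r} UNIV"
    if add: "\<And>u v. u \<in> G \<Longrightarrow> v \<in> G \<Longrightarrow> (\<lambda>p q. u p q + v p q) \<in> G"
      and G: "\<And>x r r' c c'. x \<in> G \<Longrightarrow> r \<noteq> r' \<Longrightarrow> c \<noteq> c' \<Longrightarrow> x r c = 0 \<or> x r' c' = 0"
      and x: "x \<in> G" "x r c \<noteq> 0" "x r c' \<noteq> 0" "c \<noteq> c'"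
    for G :: "('s \<Rightarrow> 't \<Rightarrow> 'a) set" and x r c c'
  proof
    fix y assume y: "y \<in> G"
    show "supp_in y {r} UNIV" unfolding supp_in_def
    proof (intro allI impI, rule ccontr)
      fix p q assume pq: "y p q \<noteq> 0" and "\<not> (p \<in> {r} \<and> q \<in> UNIV)"
      hence p: "p \<noteq> r" by simp
      obtain t where t: "t \<noteq> q" "x r t \<noteq> 0" using x by metis
      have "x p q = 0" using G[OF x(1) p t(1)[symmetric]] t by auto
      moreover have "y r t = 0" using G[OF y p t(1)[symmetric]] pq by auto
      ultimately show False using G[OF add[OF x(1) y] p t(1)[symmetric]] t pq by simp
    qed
  qed
  have G: "x r c = 0 \<or> x r' c' = 0" if "x \<in> G" "r \<noteq> r'" "c \<noteq> c'" for x r r' c c'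
    using False that by blast
  show ?thesis
  proof (cases "\<exists>x\<in>G. \<exists>r c c'. c \<noteq> c' \<and> x r c \<noteq> 0 \<and> x r c' \<noteq> 0")
    case True
    thus ?thesis using row[OF add G] by blast
  next
    case nrow: False
    show ?thesis
    proof (cases "\<exists>x\<in>G. \<exists>r r' c. r \<noteq> r' \<and> x r c \<noteq> 0 \<and> x r' c \<noteq> 0")
      case True
      then obtain x r r' c where x: "x \<in> G" "r \<noteq> r'" "x r c \<noteq> 0" "x r' c \<noteq> 0" by blast
      have "\<forall>y\<in>tr ` G. supp_in y {c} UNIV"
      proof (rule row[of "tr ` G" "tr x" c r r'])
        fix u v assume "u \<in> tr ` G" "v \<in> tr ` G"
        then obtain u' v' where "u = tr u'" "v = tr v'" "u' \<in> G" "v' \<in> G" by blast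
        thus "(\<lambda>p q. u p q + v p q) \<in> tr ` G"
          using add[of u' v'] by (intro image_eqI[of _ _ "\<lambda>p q. u' p q + v' p q"]) (auto simp: tr_def)
      next
        fix y and s s' :: 'c and t t' :: 'r assume "y \<in> tr ` G" "s \<noteq> s'" "t \<noteq> t'"
        thus "y s t = 0 \<or> y s' t' = 0" using G[of _ t t' s s'] by (force simp: tr_def)
      qed (use x in \<open>auto simp: tr_def\<close>)
      hence "\<forall>u\<in>G. supp_in u UNIV {c}" by simp
      thus ?thesis by blast
    next
      case ncol: False
      \<comment> \<open>Now each member has at most one nonzero entry; two members with entries at
        different positions would have a sum with both.\<close>
      have single: "x r c = 0 \<or> x p q = 0" if "x \<in> G" "r \<noteq> p \<or> c \<noteq> q" for x r c p q
        using that nrow ncol G by metis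
      show ?thesis
      proof (cases "\<exists>x\<in>G. \<exists>r c. x r c \<noteq> 0")
        case True
        then obtain x r c where x: "x \<in> G" "x r c \<noteq> 0" by blast
        have "supp_in y {r} UNIV" if y: "y \<in> G" for y
          unfolding supp_in_def
        proof (intro allI impI, rule ccontr)
          fix p q assume pq: "y p q \<noteq> 0" and "\<not> (p \<in> {r} \<and> q \<in> UNIV)"
          hence p: "r \<noteq> p \<or> c \<noteq> q" by simp
          have "x p q = 0" "y r c = 0" using single[OF x(1) p] single[OF y p] x pq by auto
          thus False using single[OF add[OF x(1) y] p] x pq by simp
        qed
        thus ?thesis by blast
      next
        case False
        thus ?thesis unfolding supp_in_def by blast
      qed
    qed
  qed
qed

text \<open>\<open>\<sigma>\<close> and \<open>\<tau>\<close> are the positions of the cells and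
  need not be injective, so units landing in one line of the image give no relation. The missing
  relations come from a detour through an index with another label, which \<open>i0, k0\<close> and
  \<open>j0, l0\<close> supply.\<close>

lemma product_structure:
  fixes f :: "'i \<Rightarrow> 'j \<Rightarrow> 'a::field \<Rightarrow> 'a"
  assumes nz: "\<And>i j a. i \<in> I \<Longrightarrow> j \<in> J \<Longrightarrow> a \<noteq> 0 \<Longrightarrow> f i j a \<noteq> 0"
    and rel: "\<And>i j k l a b c d. i \<in> I \<Longrightarrow> k \<in> I \<Longrightarrow> j \<in> J \<Longrightarrow> l \<in> J \<Longrightarrow> \<sigma> i \<noteq> \<sigma> k \<Longrightarrow> \<tau> j \<noteq> \<tau> l \<Longrightarrow>
      a * d = b * c \<Longrightarrow> f i j a * f k l d = f i l b * f k j c"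
    and i0: "i0 \<in> I" "k0 \<in> I" "\<sigma> i0 \<noteq> \<sigma> k0" and j0: "j0 \<in> J" "l0 \<in> J" "\<tau> j0 \<noteq> \<tau> l0"
  defines "h \<equiv> \<lambda>a. f i0 j0 a / f i0 j0 1"
  shows "h (a * b) = h a * h b"
    and "i \<in> I \<Longrightarrow> j \<in> J \<Longrightarrow> f i j a = (f i j0 1) * (f i0 j 1 / f i0 j0 1) * h a"
proof -
  define g where "g i j = f i j 1" for i j
  have g: "g i j \<noteq> 0" if "i \<in> I" "j \<in> J" for i j using nz that unfolding g_def by simp
  have rowpick: "\<exists>k\<in>I. \<sigma> k \<noteq> \<sigma> i" for i using i0 by metis
  have colpick: "\<exists>l\<in>J. \<tau> l \<noteq> \<tau> j" for j using j0 by metis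
  have gg: "g i j * g k l = g i l * g k j"
    if "i \<in> I" "k \<in> I" "j \<in> J" "l \<in> J" "\<sigma> i \<noteq> \<sigma> k" "\<tau> j \<noteq> \<tau> l" for i j k l
    unfolding g_def by (rule rel[OF that]) simp
  have gg2: "g i j * g k l = g i l * g k j"
    if ik: "i \<in> I" "k \<in> I" "j \<in> J" "l \<in> J" "\<sigma> i \<noteq> \<sigma> k" for i j k l
  proof (cases "\<tau> j = \<tau> l")
    case True
    \<comment> \<open>Compare \<open>j\<close> and \<open>l\<close> both with a column of a
      different label, and cancel the nonzero factors.\<close>
    obtain m where m: "m \<in> J" "\<tau> m \<noteq> \<tau> j" using colpick by blast
    have 1: "g i j * g k m = g i m * g k j" "g i l * g k m = g i m * g k l"
      using ik m True by (auto intro!: gg)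
    have "(g i j * g k l) * (g k m * g i m) = (g i j * g k m) * (g i m * g k l)" by (simp add: mult_ac)
    also have "\<dots> = (g i l * g k j) * (g k m * g i m)" unfolding 1(1) 1(2)[symmetric] by (simp add: mult_ac)
    finally show ?thesis using g ik m by simp
  next
    case False
    thus ?thesis using gg ik by blast
  qed
  have gg3: "g i j * g k l = g i l * g k j"
    if ik: "i \<in> I" "k \<in> I" "j \<in> J" "l \<in> J" for i j k l
  proof (cases "\<sigma> i = \<sigma> k")
    case True
    obtain p where p: "p \<in> I" "\<sigma> p \<noteq> \<sigma> i" using rowpick by blast
    have 1: "g i j * g p l = g i l * g p j" "g k j * g p l = g k l * g p j"
      using ik p True by (auto intro!: gg2)
    have "(g i j * g k l) * (g p l * g p j) = (g i j * g p l) * (g k l * g p j)" by (simp add: mult_ac)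
    also have "\<dots> = (g i l * g k j) * (g p l * g p j)" unfolding 1(1) 1(2)[symmetric] by (simp add: mult_ac)
    finally show ?thesis using g ik p by simp
  next
    case False
    thus ?thesis using gg2 ik by blast
  qed
  define H where "H i j a = f i j a / g i j" for i j a
  have diag: "H i j a = H k l a"
    if ik: "i \<in> I" "k \<in> I" "j \<in> J" "l \<in> J" "\<sigma> i \<noteq> \<sigma> k" "\<tau> j \<noteq> \<tau> l" for i j k l a
  proof -
    have "f i j a * g k l = f i l a * g k j" "g i j * f k l a = f i l a * g k j"
      unfolding g_def by (rule rel[OF ik]; simp)+
    thus ?thesis unfolding H_def using g ik by (simp add: field_simps)
  qed
  have side: "H i j a = H i l a"
    if ik: "i \<in> I" "k \<in> I" "j \<in> J" "l \<in> J" "\<sigma> i \<noteq> \<sigma> k" "\<tau> j \<noteq> \<tau> l" for i j k l a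
  proof -
    have 1: "f i j a * g k l = f i l a * g k j"
      unfolding g_def by (rule rel[OF ik]) simp
    have "f i j a * g i l * g k l = (f i j a * g k l) * g i l" by (simp add: mult_ac)
    also have "\<dots> = f i l a * (g i l * g k j)" unfolding 1 by (simp add: mult_ac)
    also have "g i l * g k j = g i j * g k l" using gg3[OF ik(1-4)] by simp
    finally have "f i j a * g i l = f i l a * g i j" using g ik by simp
    thus ?thesis unfolding H_def using g ik by (simp add: field_simps)
  qed
  have H: "H i j a = H i0 j0 a" if ij: "i \<in> I" "j \<in> J" for i j a
  proof -
    \<comment> \<open>\<open>k\<close> and \<open>l\<close> are picked among the base indices so
      that both labels differ from those of \<open>i\<close> and \<open>j\<close>. This leads to one
      of four base corners, which agree by \<open>diag\<close> and \<open>side\<close>.\<close>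
    obtain k where k: "k = i0 \<or> k = k0" "\<sigma> i \<noteq> \<sigma> k" using i0 by metis
    obtain l where l: "l = j0 \<or> l = l0" "\<tau> j \<noteq> \<tau> l" using j0 by metis
    have kl: "k \<in> I" "l \<in> J" using k l i0 j0 by auto
    have "H i j a = H k l a" using diag ij kl k l by blast
    also have "\<dots> = H i0 j0 a"
      using k l diag[OF i0(1,2) j0(1,2) i0(3) j0(3)] side[OF i0(1,2) j0(1,2) i0(3) j0(3)]
        diag[OF i0(1,2) j0(2,1) i0(3) j0(3)[symmetric]] by auto
    finally show ?thesis .
  qed
  have h: "h a = H i0 j0 a" for a by (simp add: h_def H_def g_def)
  \<comment> \<open>With the \<open>f\<close> in place of \<open>H\<close>, both products equal
    \<open>f i0 l0 (a * b) * f k0 j0 1\<close>.\<close>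
  have "H i0 j0 a * H k0 l0 b = H i0 j0 (a * b) * H k0 l0 1"
  proof -
    have "f i0 j0 a * f k0 l0 b = f i0 l0 (a * b) * f k0 j0 1" "f i0 j0 (a * b) * f k0 l0 1 = f i0 l0 (a * b) * f k0 j0 1"
      by (rule rel[OF i0(1,2) j0(1,2) i0(3) j0(3)]; simp)+
    thus ?thesis unfolding H_def by (simp add: field_simps)
  qed
  moreover have "H k0 l0 1 = 1" unfolding H_def g_def using nz i0 j0 by simp
  ultimately show "h (a * b) = h a * h b" unfolding h using H[OF i0(2) j0(2)] by simp
  assume ij: "i \<in> I" "j \<in> J"
  have "f i j a = g i j * H i j a" unfolding H_def using g[OF ij] by simp
  also have "g i j = g i j0 * (g i0 j / g i0 j0)"
    using gg3[OF ij(1) i0(1) ij(2) j0(1)] g i0 j0 by (simp add: field_simps)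
  finally show "f i j a = (f i j0 1) * (f i0 j 1 / f i0 j0 1) * h a" unfolding h using H[OF ij] by (simp add: g_def)
qed

section \<open>Classification of families\<close>

context perp_family
begin

lemma cell_nonzero:
  assumes "i \<in> I" "j \<in> J" "a \<noteq> 0" "supp_in (\<phi> i j a) {p} {q}"
  shows "\<phi> i j a p q \<noteq> 0"
  using nonzero[OF assms(1-3)] assms(4) unfolding supp_in_def by auto

lemma cellsE:
  assumes "cells i k j l"
  obtains r r' c c' where "r \<noteq> r'" "c \<noteq> c'" "\<And>a. supp_in (\<phi> i j a) {r} {c}" "\<And>a. supp_in (\<phi> i l a) {r} {c'}"
    "\<And>a. supp_in (\<phi> k j a) {r'} {c}" "\<And>a. supp_in (\<phi> k l a) {r'} {c'}"
  using assms unfolding cells_def by metis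

lemma cells_transposedE:
  assumes "cells_transposed i k j l"
  obtains r r' c c' where "r \<noteq> r'" "c \<noteq> c'" "\<And>a. supp_in (\<phi> i j a) {r} {c}" "\<And>a. supp_in (\<phi> i l a) {r'} {c}"
    "\<And>a. supp_in (\<phi> k j a) {r} {c'}" "\<And>a. supp_in (\<phi> k l a) {r'} {c'}"
  using assms unfolding cells_transposed_def by metis

text \<open>In a third column \<open>m\<close> the two images are single rows, proportional to each
  other by \<open>exchange\<close>. Proportional rows that are orthogonal satisfy
  \<open>2 * u q * u q' = 0\<close> up to a nonzero factor, so only one position is
  occupied.\<close>

lemma cells_column:
  assumes ijkl: "i \<in> I" "k \<in> I" "j \<in> J" "l \<in> J" and K: "r \<noteq> r'" "c \<noteq> c'"
    and supp: "\<And>a. supp_in (\<phi> i j a) {r} {c}" "\<And>a. supp_in (\<phi> i l a) {r} {c'}"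
      "\<And>a. supp_in (\<phi> k j a) {r'} {c}" "\<And>a. supp_in (\<phi> k l a) {r'} {c'}"
    and m: "m \<in> J"
  shows "\<exists>q. \<forall>a. supp_in (\<phi> i m a) {r} {q} \<and> supp_in (\<phi> k m a) {r'} {q}"
proof -
  define s s' t t' where "s = \<phi> i j 1 r c" and "s' = \<phi> k j 1 r' c" and "t = \<phi> i l 1 r c'" and "t' = \<phi> k l 1 r' c'"
  have nz: "s \<noteq> 0" "s' \<noteq> 0" "t \<noteq> 0" "t' \<noteq> 0"
    using cell_nonzero ijkl supp unfolding s_def s'_def t_def t'_def by simp_all
  have rowi: "supp_in (\<phi> i m a) {r} UNIV" for a
    using nz ijkl m K by (intro perp_cells_row[OF supp(1)[of 1] _ supp(2)[of 1]]) (auto simp: s_def t_def intro: row)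
  have rowk: "supp_in (\<phi> k m a) {r'} UNIV" for a
    using nz ijkl m K by (intro perp_cells_row[OF supp(3)[of 1] _ supp(4)[of 1]]) (auto simp: s'_def t'_def intro: row)
  have zi: "\<phi> i m a r' q = 0" and zk: "\<phi> k m a r q = 0" for a q
    using supp_inD[OF rowi] supp_inD[OF rowk] K by auto
  have st: "s * t' = t * s'"
  proof -
    have "pol (\<phi> i j 1) (\<phi> k l 1) r r' c c' = pol (\<phi> i l 1) (\<phi> k j 1) r r' c c'"
      using ijkl K by (intro exchange) auto
    thus ?thesis using K supp[THEN supp_inD] by (simp add: pol_def s_def s'_def t_def t'_def)
  qed
  have rel1: "s * \<phi> k m a r' q = s' * \<phi> i m a r q" if q: "q \<noteq> c" for a q
  proof -
    have "pol (\<phi> i j 1) (\<phi> k m a) r r' c q = pol (\<phi> i m a) (\<phi> k j 1) r r' c q"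
      using ijkl m K q by (intro exchange) auto
    moreover have "\<phi> i j 1 r q = 0" "\<phi> i j 1 r' q = 0" "\<phi> i j 1 r' c = 0" "\<phi> k j 1 r q = 0" "\<phi> k j 1 r' q = 0" "\<phi> k j 1 r c = 0"
      using q K by (auto intro!: supp[THEN supp_inD])
    ultimately show ?thesis by (simp add: pol_def s_def s'_def mult.commute)
  qed
  have rel2: "t * \<phi> k m a r' q = t' * \<phi> i m a r q" if q: "q \<noteq> c'" for a q
  proof -
    have "pol (\<phi> i l 1) (\<phi> k m a) r r' c' q = pol (\<phi> i m a) (\<phi> k l 1) r r' c' q"
      using ijkl m K q by (intro exchange) auto
    moreover have "\<phi> i l 1 r q = 0" "\<phi> i l 1 r' q = 0" "\<phi> i l 1 r' c' = 0" "\<phi> k l 1 r q = 0" "\<phi> k l 1 r' q = 0" "\<phi> k l 1 r c' = 0"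
      using q K by (auto intro!: supp[THEN supp_inD])
    ultimately show ?thesis by (simp add: pol_def t_def t'_def mult.commute)
  qed
  \<comment> \<open>At \<open>q = c\<close> there is no minor to compare with column
    \<open>j\<close>; column \<open>l\<close> and \<open>st\<close> fill the gap.\<close>
  have rel: "s * \<phi> k m a r' q = s' * \<phi> i m a r q" for a q
  proof (cases "q = c")
    case True
    hence "t * (s * \<phi> k m a r' q) = (s * t') * \<phi> i m a r q" using rel2[of q a] K by (simp add: mult_ac)
    also have "\<dots> = t * (s' * \<phi> i m a r q)" unfolding st by (simp add: mult_ac)
    finally show ?thesis using nz by simp
  qed (rule rel1)
  have colm: "perp (\<phi> i m a) (\<phi> k m b)" for a b using ijkl m by (intro col)
  obtain q where q: "\<phi> i m 1 r q \<noteq> 0"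
  proof -
    obtain p q where "\<phi> i m 1 p q \<noteq> 0" using nonzero[OF ijkl(1) m] one_neq_zero by blast
    moreover hence "p = r" using rowi unfolding supp_in_def by blast
    ultimately show ?thesis using that by blast
  qed
  hence qk: "\<phi> k m 1 r' q \<noteq> 0" using rel[of 1 q] nz by auto
  have "\<phi> i m a r q' = 0" "\<phi> k m a r' q' = 0" if q': "q' \<noteq> q" for a q'
  proof -
    have "pol (\<phi> i m a) (\<phi> k m 1) r r' q' q = 0" "pol (\<phi> i m 1) (\<phi> k m a) r r' q' q = 0"
      using K q' by (auto intro: perpD[OF colm])
    hence 1: "\<phi> i m a r q' * \<phi> k m 1 r' q + \<phi> i m a r q * \<phi> k m 1 r' q' = 0"
      "\<phi> i m 1 r q' * \<phi> k m a r' q + \<phi> i m 1 r q * \<phi> k m a r' q' = 0"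
      by (simp_all add: pol_def zi zk)
    have 2: "\<phi> i m 1 r q' = 0"
    proof -
      have "0 = s * (\<phi> i m 1 r q' * \<phi> k m 1 r' q + \<phi> i m 1 r q * \<phi> k m 1 r' q')"
        using perpD[OF colm[of 1 1] K(1) q'] by (simp add: pol_def zi zk)
      also have "\<dots> = \<phi> i m 1 r q' * (s * \<phi> k m 1 r' q) + \<phi> i m 1 r q * (s * \<phi> k m 1 r' q')"
        by (simp add: algebra_simps)
      also have "\<dots> = 2 * (s' * \<phi> i m 1 r q * \<phi> i m 1 r q')"
        unfolding rel by (simp add: algebra_simps)
      finally have "2 * (s' * \<phi> i m 1 r q * \<phi> i m 1 r q') = 0" ..
      thus ?thesis using two nz q unfolding mult_eq_0_iff by blast
    qed
    hence "\<phi> k m 1 r' q' = 0" using rel[of 1 q'] nz by simp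
    thus "\<phi> i m a r q' = 0" "\<phi> k m a r' q' = 0" using 1 2 q qk by auto
  qed
  hence "supp_in (\<phi> i m a) {r} {q} \<and> supp_in (\<phi> k m a) {r'} {q}" for a
    using rowi[of a] rowk[of a] unfolding supp_in_def by blast
  thus ?thesis by blast
qed

text \<open>Once rows \<open>i, k\<close> and columns \<open>j, l\<close> consist of cells, every
  other image is orthogonal to two cells in row \<open>\<sigma> m\<close> and to two cells in column
  \<open>\<tau> n\<close>.\<close>

lemma cells_maps:
  assumes ijkl: "i \<in> I" "k \<in> I" "j \<in> J" "l \<in> J" and cells: "cells i k j l"
  obtains \<sigma> \<tau> where "\<sigma> i \<noteq> \<sigma> k" "\<tau> j \<noteq> \<tau> l"
    "\<And>m n a. m \<in> I \<Longrightarrow> n \<in> J \<Longrightarrow> supp_in (\<phi> m n a) {\<sigma> m} {\<tau> n}"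
proof -
  obtain r r' c c' where K: "r \<noteq> r'" "c \<noteq> c'"
    and supp: "\<And>a. supp_in (\<phi> i j a) {r} {c}" "\<And>a. supp_in (\<phi> i l a) {r} {c'}"
      "\<And>a. supp_in (\<phi> k j a) {r'} {c}" "\<And>a. supp_in (\<phi> k l a) {r'} {c'}"
    using cells by (rule cellsE) blast
  \<comment> \<open>Units and images are both transposed, so the arrangement keeps its shape and
    \<open>cells_column\<close> yields the row map \<open>\<sigma>\<close>.\<close>
  interpret T: perp_family J I "\<lambda>j i a. tr (\<phi> i j a)"
    by (rule perp_family.transpose_out[OF transpose_in])
  have uniq: "q = q'" if "supp_in (\<phi> m n 1) {p} {q}" "supp_in (\<phi> m n 1) {p'} {q'}" "m \<in> I" "n \<in> J" for m n p q p' q'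
    using cell_nonzero[OF that(3,4) one_neq_zero that(1)] that(2) unfolding supp_in_def by blast
  have uniq': "p = p'" if "supp_in (\<phi> m n 1) {p} {q}" "supp_in (\<phi> m n 1) {p'} {q'}" "m \<in> I" "n \<in> J" for m n p q p' q'
    using cell_nonzero[OF that(3,4) one_neq_zero that(1)] that(2) unfolding supp_in_def by blast
  have "\<forall>m\<in>J. \<exists>q. \<forall>a. supp_in (\<phi> i m a) {r} {q} \<and> supp_in (\<phi> k m a) {r'} {q}"
    using cells_column[OF ijkl K supp] by blast
  from bchoice[OF this] obtain \<tau>
    where \<tau>: "\<And>m a. m \<in> J \<Longrightarrow> supp_in (\<phi> i m a) {r} {\<tau> m}" "\<And>m a. m \<in> J \<Longrightarrow> supp_in (\<phi> k m a) {r'} {\<tau> m}"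
    by blast
  have "\<forall>m\<in>I. \<exists>q. \<forall>a. supp_in (tr (\<phi> m j a)) {c} {q} \<and> supp_in (tr (\<phi> m l a)) {c'} {q}"
    using T.cells_column[of j l i k c c' r r'] ijkl K supp by simp
  from bchoice[OF this, unfolded supp_in_tr] obtain \<sigma>
    where \<sigma>: "\<And>m a. m \<in> I \<Longrightarrow> supp_in (\<phi> m j a) {\<sigma> m} {c}" "\<And>m a. m \<in> I \<Longrightarrow> supp_in (\<phi> m l a) {\<sigma> m} {c'}"
    by blast
  have vals: "\<sigma> i = r" "\<sigma> k = r'" "\<tau> j = c" "\<tau> l = c'"
    using uniq'[OF \<sigma>(1)[OF ijkl(1)] supp(1) ijkl(1,3)] uniq'[OF \<sigma>(1)[OF ijkl(2)] supp(3) ijkl(2,3)]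
      uniq[OF \<tau>(1)[OF ijkl(3)] supp(1) ijkl(1,3)] uniq[OF \<tau>(1)[OF ijkl(4)] supp(2) ijkl(1,4)] .
  have "supp_in (\<phi> m n a) {\<sigma> m} {\<tau> n}" if mn: "m \<in> I" "n \<in> J" for m n a
  proof -
    have "supp_in (\<phi> m n a) {\<sigma> m} UNIV"
      using ijkl mn K by (intro perp_cells_row[OF \<sigma>(1)[OF mn(1), of 1] _ \<sigma>(2)[OF mn(1), of 1]])
        (simp_all add: row cell_nonzero[OF _ _ one_neq_zero \<sigma>(1)] cell_nonzero[OF _ _ one_neq_zero \<sigma>(2)])
    moreover have "supp_in (tr (\<phi> m n a)) {\<tau> n} UNIV"
    proof (rule perp_cells_row[of "tr (\<phi> i n 1)" _ r "tr (\<phi> k n 1)" r'])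
      show "tr (\<phi> i n 1) (\<tau> n) r \<noteq> 0" "tr (\<phi> k n 1) (\<tau> n) r' \<noteq> 0"
        unfolding tr_def using cell_nonzero ijkl mn \<tau> by auto
    qed (use ijkl mn K \<tau> in \<open>auto intro: col\<close>)
    ultimately show ?thesis unfolding supp_in_tr unfolding supp_in_def by blast
  qed
  thus ?thesis using that[of \<sigma> \<tau>] vals K by blast
qed

lemma cells_formula:
  assumes ijkl: "i \<in> I" "k \<in> I" "j \<in> J" "l \<in> J" and cells: "cells i k j l"
  obtains \<sigma> \<tau> d e h where "\<And>m. m \<in> I \<Longrightarrow> d m \<noteq> 0" "\<And>n. n \<in> J \<Longrightarrow> e n \<noteq> 0" "h 1 = (1::'a)"
    "\<And>a b. h (a + b) = h a + h b" "\<And>a b. h (a * b) = h a * h b"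
    "\<And>m n a p q. m \<in> I \<Longrightarrow> n \<in> J \<Longrightarrow> \<phi> m n a p q = (if p = \<sigma> m \<and> q = \<tau> n then d m * e n * h a else 0)"
proof -
  obtain \<sigma> \<tau> where st: "\<sigma> i \<noteq> \<sigma> k" "\<tau> j \<noteq> \<tau> l"
    and supp: "\<And>m n a. m \<in> I \<Longrightarrow> n \<in> J \<Longrightarrow> supp_in (\<phi> m n a) {\<sigma> m} {\<tau> n}"
    using cells_maps[OF ijkl cells] by blast
  define f where "f m n a = \<phi> m n a (\<sigma> m) (\<tau> n)" for m n a
  have nz: "f m n a \<noteq> 0" if "m \<in> I" "n \<in> J" "a \<noteq> 0" for m n a
    unfolding f_def using cell_nonzero that supp by blast
  \<comment> \<open>The chosen positions form a minor only if both labels differ, hence the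
    inequalities in \<open>product_structure\<close>.\<close>
  have rel: "f m n a * f m' n' d = f m n' b * f m' n c"
    if mn: "m \<in> I" "m' \<in> I" "n \<in> J" "n' \<in> J" "\<sigma> m \<noteq> \<sigma> m'" "\<tau> n \<noteq> \<tau> n'" "a * d = b * c" for m n m' n' a b c d
  proof -
    have "pol (\<phi> m n a) (\<phi> m' n' d) (\<sigma> m) (\<sigma> m') (\<tau> n) (\<tau> n') = pol (\<phi> m n' b) (\<phi> m' n c) (\<sigma> m) (\<sigma> m') (\<tau> n) (\<tau> n')"
      using mn by (intro exchange) auto
    moreover have "\<phi> m n a (\<sigma> m') q = 0" "\<phi> m n' b (\<sigma> m') q = 0" for q
      using mn by (auto intro!: supp[THEN supp_inD])
    moreover have "\<phi> m n a p (\<tau> n') = 0" "\<phi> m n' b p (\<tau> n) = 0" for p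
      using mn by (auto intro!: supp[THEN supp_inD])
    ultimately show ?thesis by (simp add: pol_def f_def)
  qed
  define h where "h a = f i j a / f i j 1" for a
  have ps1: "h (a * b) = h a * h b" for a b
    unfolding h_def by (rule product_structure(1)[of I J f \<sigma> \<tau> i k j l]) (fact nz rel ijkl st)+
  have ps2: "f m n a = f m j 1 * (f i n 1 / f i j 1) * h a" if "m \<in> I" "n \<in> J" for m n a
    unfolding h_def by (rule product_structure(2)[of I J f \<sigma> \<tau> i k j l]) (fact nz rel ijkl st that)+
  show ?thesis
  proof
    show "f m j 1 \<noteq> 0" if "m \<in> I" for m using nz that ijkl by simp
    show "f i n 1 / f i j 1 \<noteq> 0" if "n \<in> J" for n using nz that ijkl by simp
    show "h 1 = 1" unfolding h_def using nz ijkl by simp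
    show "h (a + b) = h a + h b" for a b
      unfolding h_def f_def add[OF ijkl(1,3)] by (simp add: add_divide_distrib)
    show "h (a * b) = h a * h b" for a b by (rule ps1)
    fix m n a p q assume mn: "m \<in> I" "n \<in> J"
    show "\<phi> m n a p q = (if p = \<sigma> m \<and> q = \<tau> n then f m j 1 * (f i n 1 / f i j 1) * h a else 0)"
    proof (cases "p = \<sigma> m \<and> q = \<tau> n")
      case True
      thus ?thesis using ps2[OF mn, of a] by (simp add: f_def)
    next
      case False
      thus ?thesis using supp_inD[OF supp[OF mn, of a], of p q] by auto
    qed
  qed
qed

text \<open>\<open>active_cells\<close> treats a leak in row \<open>i\<close>. Leaks in row
  \<open>k\<close> and in columns \<open>j, l\<close> are brought there by swapping the units of the
  block and by transposing the domain.\<close>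

lemma trichotomy:
  obtains (perp) "\<And>i j k l a d. i \<in> I \<Longrightarrow> j \<in> J \<Longrightarrow> k \<in> I \<Longrightarrow> l \<in> J \<Longrightarrow> perp (\<phi> i j a) (\<phi> k l d)"
  | (block) r r' c c' where "\<And>i j a. i \<in> I \<Longrightarrow> j \<in> J \<Longrightarrow> supp_in (\<phi> i j a) {r, r'} {c, c'}"
  | (cells) i k j l where "i \<in> I" "k \<in> I" "j \<in> J" "l \<in> J" "cells i k j l"
  | (cells_transposed) i k j l where "i \<in> I" "k \<in> I" "j \<in> J" "l \<in> J" "cells_transposed i k j l"
proof (cases "\<forall>i\<in>I. \<forall>j\<in>J. \<forall>k\<in>I. \<forall>l\<in>J. \<forall>a d. perp (\<phi> i j a) (\<phi> k l d)")
  case True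
  thus ?thesis using perp by blast
next
  case False
  then obtain i j k l a d r r' c c' where ijkl: "i \<in> I" "k \<in> I" "j \<in> J" "l \<in> J" and K: "r \<noteq> r'" "c \<noteq> c'"
    and pol: "pol (\<phi> i j a) (\<phi> k l d) r r' c c' \<noteq> 0"
    unfolding perp_def by blast
  interpret T: perp_family J I "\<lambda>j i. \<phi> i j" by (rule transpose_in)
  have fin: thesis if "cells i k j l \<or> cells_transposed i k j l" "i \<in> I" "k \<in> I" "j \<in> J" "l \<in> J" for i k j l
    using that(1) cells[OF that(2-5)] cells_transposed[OF that(2-5)] by blast
  \<comment> \<open>Transposing the domain alone exchanges the two arrangements.\<close>
  have conv: "cells i k j l \<or> cells_transposed i k j l" if "T.cells j l i k \<or> T.cells_transposed j l i k" for i k j l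
    using that
  proof
    assume "T.cells j l i k"
    thus ?thesis by (elim T.cellsE) (intro disjI2 cells_transposedI)
  next
    assume "T.cells_transposed j l i k"
    thus ?thesis by (elim T.cells_transposedE) (intro disjI1 cellsI)
  qed
  have pol': "pol (\<phi> k l d) (\<phi> i j a) r r' c c' \<noteq> 0" using pol by (simp add: pol_sym)
  note act = activeI[OF ijkl K pol] activeI[OF ijkl(2,1,4,3) K pol']
    T.activeI[OF ijkl(3,4,1,2) K pol] T.activeI[OF ijkl(4,3,2,1) K pol']
  show ?thesis
  proof (cases "(\<forall>m\<in>J. \<forall>a. supp_in (\<phi> i m a) {r, r'} {c, c'} \<and> supp_in (\<phi> k m a) {r, r'} {c, c'}) \<and>
      (\<forall>m\<in>I. \<forall>a. supp_in (\<phi> m j a) {r, r'} {c, c'} \<and> supp_in (\<phi> m l a) {r, r'} {c, c'})")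
    case True
    show ?thesis
      by (rule block[of r r' c c'], rule active_supp[OF ijkl act(1)]) (use True in blast)+
  next
    case False
    then consider m b where "m \<in> J" "\<not> supp_in (\<phi> i m b) {r, r'} {c, c'}"
      | m b where "m \<in> J" "\<not> supp_in (\<phi> k m b) {r, r'} {c, c'}"
      | m b where "m \<in> I" "\<not> supp_in (\<phi> m j b) {r, r'} {c, c'}"
      | m b where "m \<in> I" "\<not> supp_in (\<phi> m l b) {r, r'} {c, c'}" by blast
    thus ?thesis
    proof cases
      case 1
      show ?thesis by (rule fin[OF active_cells[OF ijkl act(1) 1] ijkl])
    next
      case 2
      show ?thesis by (rule fin[OF active_cells[OF ijkl(2,1,4,3) act(2) 2] ijkl(2,1,4,3)])
    next
      case 3
      show ?thesis by (rule fin[OF conv[OF T.active_cells[OF ijkl(3,4,1,2) act(3) 3]] ijkl])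
    next
      case 4
      show ?thesis by (rule fin[OF conv[OF T.active_cells[OF ijkl(4,3,2,1) act(4) 4]] ijkl(2,1,4,3)])
    qed
  qed
qed

end

section \<open>Matrices of permanent rank one\<close>

text \<open>Entries outside the matrix are set to \<open>0\<close>, so that minors with indices out of range vanish.\<close>
definition entries :: "'a::zero mat \<Rightarrow> nat \<Rightarrow> nat \<Rightarrow> 'a" where
  "entries A p q = (if p < dim_row A \<and> q < dim_col A then A $$ (p, q) else 0)"

lemma permutes_two: "{p. p permutes {0..<2::nat}} = {id, transpose 0 1}"
proof (intro equalityI subsetI)
  fix p assume "p \<in> {p. p permutes {0..<2::nat}}"
  hence p: "p permutes {0..<2}" by simp
  have out: "p x = x" if "x \<noteq> 0" "x \<noteq> 1" for x
    using permutes_not_in[OF p] that by auto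
  have "p 0 \<in> {0..<2}" "p 1 \<in> {0..<2}" using permutes_in_image[OF p] by auto
  moreover have "p 0 \<noteq> p 1" using permutes_inj[OF p] by (metis injD zero_neq_one)
  ultimately have "p 0 = 0 \<and> p 1 = 1 \<or> p 0 = 1 \<and> p 1 = 0" by auto
  thus "p \<in> {id, transpose 0 1}"
  proof
    assume "p 0 = 0 \<and> p 1 = 1"
    hence "p x = id x" for x using out[of x] by (cases "x = 0 \<or> x = 1") auto
    thus ?thesis by auto
  next
    assume "p 0 = 1 \<and> p 1 = 0"
    hence "p x = transpose 0 1 x" for x using out[of x] by (cases "x = 0 \<or> x = 1") auto
    thus ?thesis by auto
  qed
next
  fix p :: "nat \<Rightarrow> nat" assume "p \<in> {id, transpose 0 1}"
  thus "p \<in> {p. p permutes {0..<2}}"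
    by (auto intro: permutes_id permutes_swap_id)
qed

lemma pick_doubleton:
  assumes "r < r'"
  shows "pick {r, r'} 0 = r" "pick {r, r'} (Suc 0) = r'"
proof -
  have "{a \<in> {r, r'}. a < r} = {}" "{a \<in> {r, r'}. a < r'} = {r}" using assms by auto
  hence c: "card {a \<in> {r, r'}. a < r} = 0" "card {a \<in> {r, r'}. a < r'} = Suc 0" by simp_all
  show "pick {r, r'} 0 = r" "pick {r, r'} (Suc 0) = r'"
    using pick_card_in_set[of r "{r, r'}"] pick_card_in_set[of r' "{r, r'}"] unfolding c by (simp_all del: pick.simps)
qed

lemma pick_singleton: "pick {r} 0 = r"
proof -
  have "{a \<in> {r}. a < r} = {}" by auto
  hence c: "card {a \<in> {r}. a < r} = 0" by simp
  show ?thesis using pick_card_in_set[of r "{r}"] unfolding c by (simp del: pick.simps)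
qed

lemma dim_submatrix_subset:
  assumes "A \<in> carrier_mat n n" "I \<subseteq> {..<n}" "J \<subseteq> {..<n}"
  shows "dim_row (submatrix A I J) = card I" "dim_col (submatrix A I J) = card J"
proof -
  have "{i. i < n \<and> i \<in> I} = I" "{j. j < n \<and> j \<in> J} = J" using assms by auto
  thus "dim_row (submatrix A I J) = card I" "dim_col (submatrix A I J) = card J"
    using assms by (simp_all add: dim_submatrix)
qed

lemma submatrix_entry:
  assumes "A \<in> carrier_mat n n" "I \<subseteq> {..<n}" "J \<subseteq> {..<n}" "i < card I" "j < card J"
  shows "submatrix A I J $$ (i, j) = A $$ (pick I i, pick J j)"
  using assms dim_submatrix_subset[OF assms(1-3)] by (simp add: submatrix_def)

lemma permanent_doubleton:
  fixes A :: "'a::comm_semiring_1 mat"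
  assumes A: "A \<in> carrier_mat n n" and r: "r < r'" "r' < n" and c: "c < c'" "c' < n"
  shows "permanent (submatrix A {r, r'} {c, c'}) = A $$ (r, c) * A $$ (r', c') + A $$ (r, c') * A $$ (r', c)"
proof -
  have sub: "{r, r'} \<subseteq> {..<n}" "{c, c'} \<subseteq> {..<n}" and cards: "card {r, r'} = 2" "card {c, c'} = 2"
    using r c by auto
  note entry = submatrix_entry[OF A sub, unfolded cards]
  have "id \<noteq> transpose 0 (1::nat)" by (metis id_apply transpose_apply_first zero_neq_one)
  moreover have "{0..<2} = {0, Suc 0}" by auto
  ultimately show ?thesis
    unfolding permanent_def dim_submatrix_subset[OF A sub] cards permutes_two
    using r c by (simp add: entry pick_doubleton del: pick.simps)
qed

lemma permanent_singleton:
  fixes A :: "'a::comm_semiring_1 mat"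
  assumes A: "A \<in> carrier_mat n n" and r: "r < n" "c < n"
  shows "permanent (submatrix A {r} {c}) = A $$ (r, c)"
proof -
  have sub: "{r} \<subseteq> {..<n}" "{c} \<subseteq> {..<n}" using r by auto
  have "p permutes {0..<1::nat} \<longleftrightarrow> p = id" for p
  proof
    assume p: "p permutes {0..<1}"
    have "p x = x" for x
      using permutes_not_in[OF p, of x] permutes_in_image[OF p, of 0] by (cases "x = 0") auto
    thus "p = id" by auto
  qed (simp add: permutes_id)
  thus ?thesis
    unfolding permanent_def dim_submatrix_subset[OF A sub]
    by (simp add: submatrix_entry[OF A sub] pick_singleton del: pick.simps)
qed

lemma permanent_zero_row:
  fixes A :: "'a::comm_semiring_1 mat"
  assumes A: "A \<in> carrier_mat n n" and IJ: "I \<subseteq> {..<n}" "J \<subseteq> {..<n}" "card I = card J"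
    and i: "i \<in> I" "\<And>q. q < n \<Longrightarrow> A $$ (i, q) = 0"
  shows "permanent (submatrix A I J) = 0"
proof -
  have fin: "finite I" "finite J" using IJ finite_subset by blast+
  \<comment> \<open>The rank of \<open>i\<close> within \<open>I\<close>, that is, the number of the
    vanishing row of the submatrix.\<close>
  define k where "k = card {a\<in>I. a < i}"
  have k: "k < card I" unfolding k_def using i(1) by (intro psubset_card_mono fin) auto
  have pk: "pick I k = i" unfolding k_def using pick_card_in_set i by blast
  have "(\<Prod>x = 0..<card I. submatrix A I J $$ (x, p x)) = 0" if p: "p permutes {0..<card I}" for p
  proof (rule prod_zero)
    have "p k < card J" using permutes_in_image[OF p, of k] k IJ by auto
    moreover from this have "pick J (p k) < n" using pick_in_set_le[of "p k" J] IJ by auto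
    ultimately show "\<exists>x\<in>{0..<card I}. submatrix A I J $$ (x, p x) = 0"
      using k pk i by (intro bexI[of _ k]) (auto simp: submatrix_entry[OF A IJ(1,2)])
  qed simp
  thus ?thesis unfolding permanent_def dim_submatrix_subset[OF A IJ(1,2)] by simp
qed

lemma permanent_zero_col:
  fixes A :: "'a::comm_semiring_1 mat"
  assumes A: "A \<in> carrier_mat n n" and IJ: "I \<subseteq> {..<n}" "J \<subseteq> {..<n}" "card I = card J"
    and j: "j \<in> J" "\<And>p. p < n \<Longrightarrow> A $$ (p, j) = 0"
  shows "permanent (submatrix A I J) = 0"
proof -
  have fin: "finite I" "finite J" using IJ finite_subset by blast+
  define k where "k = card {a\<in>J. a < j}"
  have k: "k < card J" unfolding k_def using j(1) by (intro psubset_card_mono fin) auto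
  have pk: "pick J k = j" unfolding k_def using pick_card_in_set j by blast
  have "(\<Prod>x = 0..<card I. submatrix A I J $$ (x, p x)) = 0" if p: "p permutes {0..<card I}" for p
  proof (rule prod_zero)
    obtain x where x: "p x = k" using permutes_surj[OF p] by (metis surjD)
    hence xI: "x < card I" using permutes_in_image[OF p, of x] k IJ by auto
    moreover from this have "pick I x < n" using pick_in_set_le[of x I] IJ by auto
    ultimately show "\<exists>x\<in>{0..<card I}. submatrix A I J $$ (x, p x) = 0"
      using k pk j x IJ by (intro bexI[of _ x]) (auto simp: submatrix_entry[OF A IJ(1,2)])
  qed simp
  thus ?thesis unfolding permanent_def dim_submatrix_subset[OF A IJ(1,2)] by simp
qed

lemma finite_permanent_sizes:
  "finite {m. \<exists>I J. I \<subseteq> {..<n::nat} \<and> J \<subseteq> {..<n'::nat} \<and> card I = m \<and> card J = m \<and> Q I J}"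
proof (rule finite_subset)
  show "{m. \<exists>I J. I \<subseteq> {..<n::nat} \<and> J \<subseteq> {..<n'::nat} \<and> card I = m \<and> card J = m \<and> Q I J} \<subseteq> {..n}"
    using card_mono[of "{..<n}"] by fastforce
qed simp

lemma Lambda1_entries_perp:
  fixes A :: "'a::field mat"
  assumes A: "A \<in> Lambda1 n"
  shows "perp (entries A) (entries A)"
  unfolding perp_def
proof (intro allI impI)
  fix r r' c c' :: nat assume rc: "r \<noteq> r'" "c \<noteq> c'"
  have cA: "A \<in> carrier_mat n n" and rk: "permanent_rank A = 1" using A by (auto simp: Lambda1_def)
  \<comment> \<open>\<open>submatrix\<close> lists its indices in increasing order, so ordered
    indices come first; the symmetries of \<open>pol\<close> cover the rest.\<close>
  have main: "pol (entries A) (entries A) r r' c c' = 0" if rc: "r < r'" "c < c'" for r r' c c'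
  proof (cases "r' < n \<and> c' < n")
    case True
    have "A $$ (r, c) * A $$ (r', c') + A $$ (r, c') * A $$ (r', c) = 0"
    proof (rule ccontr)
      assume "\<not> ?thesis"
      hence "permanent (submatrix A {r, r'} {c, c'}) \<noteq> 0"
        using permanent_doubleton[OF cA] rc True by simp
      moreover have "{r, r'} \<subseteq> {..<dim_row A}" "{c, c'} \<subseteq> {..<dim_col A}" "card {r, r'} = 2" "card {c, c'} = 2"
        using rc True cA by auto
      ultimately have "2 \<le> permanent_rank A"
        unfolding permanent_rank_def by (intro Max_ge finite_permanent_sizes) blast
      thus False using rk by simp
    qed
    thus ?thesis using True rc cA unfolding pol_self by (simp add: entries_def)
  next
    case False
    thus ?thesis using cA by (auto simp: pol_def entries_def)
  qed
  show "pol (entries A) (entries A) r r' c c' = 0"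
    using main[of r r' c c'] main[of r' r c c'] main[of r r' c' c] main[of r' r c' c] rc
    by (cases "r < r'"; cases "c < c'") (simp_all add: pol_swap_rows pol_swap_cols)
qed

lemma Lambda1_nonzero:
  assumes "A \<in> Lambda1 n"
  shows "\<exists>p q. entries A p q \<noteq> 0"
proof (rule ccontr)
  assume "\<not> ?thesis"
  hence zero: "entries A p q = 0" for p q by blast
  have A: "A \<in> carrier_mat n n" using assms by (simp add: Lambda1_def)
  have "A $$ (p, q) = 0" if "p < n" "q < n" for p q
    using zero[of p q] that A by (simp add: entries_def)
  hence "A = 0\<^sub>m n n" using A by (intro eq_matI) auto
  thus False using assms by (simp add: Lambda1_def permanent_rank_zero_mat)
qed

lemma Lambda1I:
  fixes A :: "'a::field mat"
  assumes A: "A \<in> carrier_mat n n" and nz: "A \<noteq> 0\<^sub>m n n"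
    and van: "\<And>I J. I \<subseteq> {..<n} \<Longrightarrow> J \<subseteq> {..<n} \<Longrightarrow> card I = card J \<Longrightarrow> 2 \<le> card I \<Longrightarrow> permanent (submatrix A I J) = 0"
  shows "A \<in> Lambda1 n"
proof -
  let ?S = "{m. \<exists>I J. I \<subseteq> {..<dim_row A} \<and> J \<subseteq> {..<dim_col A}
     \<and> card I = m \<and> card J = m \<and> permanent (submatrix A I J) \<noteq> 0}"
  obtain p q where pq: "p < n" "q < n" "A $$ (p, q) \<noteq> 0"
  proof -
    have "\<exists>p q. p < n \<and> q < n \<and> A $$ (p, q) \<noteq> 0"
    proof (rule ccontr)
      assume "\<not> ?thesis"
      hence "A = 0\<^sub>m n n" using A by (intro eq_matI) auto
      thus False using nz by simp
    qed
    thus ?thesis using that by blast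
  qed
  have "1 \<in> ?S"
    using pq A permanent_singleton[OF A pq(1,2)] by (intro CollectI exI[of _ "{p}"] exI[of _ "{q}"]) auto
  moreover have "m \<le> 1" if m: "m \<in> ?S" for m
  proof (rule ccontr)
    assume "\<not> m \<le> 1"
    moreover obtain I J where "I \<subseteq> {..<n}" "J \<subseteq> {..<n}" "card I = m" "card J = m" "permanent (submatrix A I J) \<noteq> 0"
      using m carrier_matD[OF A] by auto
    ultimately show False using van[of I J] by simp
  qed
  ultimately have "permanent_rank A = 1"
    unfolding permanent_rank_def by (intro Max_eqI finite_permanent_sizes) auto
  thus ?thesis using A by (simp add: Lambda1_def)
qed

lemma Lambda1_row:
  fixes A :: "'a::field mat"
  assumes A: "A \<in> carrier_mat n n" and nz: "A \<noteq> 0\<^sub>m n n" and row: "\<And>p q. p < n \<Longrightarrow> q < n \<Longrightarrow> p \<noteq> r \<Longrightarrow> A $$ (p, q) = 0"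
  shows "A \<in> Lambda1 n"
proof (rule Lambda1I[OF A nz])
  fix I J assume IJ: "I \<subseteq> {..<n}" "J \<subseteq> {..<n}" "card I = card J" "2 \<le> card I"
  have "\<exists>i\<in>I. i \<noteq> r"
  proof (rule ccontr)
    assume "\<not> ?thesis"
    hence "card I \<le> card {r}" by (intro card_mono) auto
    thus False using IJ(4) by simp
  qed
  thus "permanent (submatrix A I J) = 0" using permanent_zero_row[OF A IJ(1-3)] row IJ(1) by blast
qed

lemma Lambda1_col:
  fixes A :: "'a::field mat"
  assumes A: "A \<in> carrier_mat n n" and nz: "A \<noteq> 0\<^sub>m n n" and col: "\<And>p q. p < n \<Longrightarrow> q < n \<Longrightarrow> q \<noteq> c \<Longrightarrow> A $$ (p, q) = 0"
  shows "A \<in> Lambda1 n"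
proof (rule Lambda1I[OF A nz])
  fix I J assume IJ: "I \<subseteq> {..<n}" "J \<subseteq> {..<n}" "card I = card J" "2 \<le> card I"
  have "\<exists>j\<in>J. j \<noteq> c"
  proof (rule ccontr)
    assume "\<not> ?thesis"
    hence "card J \<le> card {c}" by (intro card_mono) auto
    thus False using IJ(3,4) by simp
  qed
  thus "permanent (submatrix A I J) = 0" using permanent_zero_col[OF A IJ(1-3)] col IJ(2) by blast
qed

lemma Lambda1_block:
  fixes A :: "'a::field mat"
  assumes A: "A \<in> carrier_mat n n" and nz: "A \<noteq> 0\<^sub>m n n" and r: "r < r'" "r' < n" and c: "c < c'" "c' < n"
    and supp: "\<And>p q. p < n \<Longrightarrow> q < n \<Longrightarrow> p \<notin> {r, r'} \<or> q \<notin> {c, c'} \<Longrightarrow> A $$ (p, q) = 0"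
    and iso: "A $$ (r, c) * A $$ (r', c') + A $$ (r, c') * A $$ (r', c) = 0"
  shows "A \<in> Lambda1 n"
proof (rule Lambda1I[OF A nz])
  have sub: "S = {a, b}" if "S \<subseteq> {a, b}" "2 \<le> card S" "a < b" for S and a b :: nat
    by (rule card_seteq) (use that in simp_all)
  fix I J assume IJ: "I \<subseteq> {..<n}" "J \<subseteq> {..<n}" "card I = card J" "2 \<le> card I"
  show "permanent (submatrix A I J) = 0"
  proof (cases "I \<subseteq> {r, r'} \<and> J \<subseteq> {c, c'}")
    case True
    hence "I = {r, r'}" "J = {c, c'}" using sub IJ r c by auto
    thus ?thesis using permanent_doubleton[OF A r c] iso by simp
  next
    case False
    then consider i where "i \<in> I" "i \<notin> {r, r'}" | j where "j \<in> J" "j \<notin> {c, c'}" by blast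
    thus ?thesis
    proof cases
      case 1
      thus ?thesis using permanent_zero_row[OF A IJ(1-3) 1(1)] supp IJ(1) by blast
    next
      case 2
      thus ?thesis using permanent_zero_col[OF A IJ(1-3) 2(1)] supp IJ(2) by blast
    qed
  qed
qed

section \<open>Additive maps preserving permanent rank one\<close>

definition single_mat :: "nat \<Rightarrow> nat \<Rightarrow> nat \<Rightarrow> 'a::zero \<Rightarrow> 'a mat" where
  "single_mat n i j a = mat n n (\<lambda>(k, l). if k = i \<and> l = j then a else 0)"

lemma single_mat_carrier [simp]: "single_mat n i j a \<in> carrier_mat n n"
  by (simp add: single_mat_def)

lemma single_mat_index [simp]:
  "p < n \<Longrightarrow> q < n \<Longrightarrow> single_mat n i j a $$ (p, q) = (if p = i \<and> q = j then a else 0)"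
  by (simp add: single_mat_def)

lemma entries_add:
  fixes A B :: "'a::field mat"
  assumes "A \<in> carrier_mat n n" "B \<in> carrier_mat n n"
  shows "entries (A + B) = (\<lambda>p q. entries A p q + entries B p q)"
  using assms by (auto simp: entries_def fun_eq_iff)

lemma perp_add_left: "perp u w \<Longrightarrow> perp v w \<Longrightarrow> perp (\<lambda>p q. u p q + v p q) w"
  unfolding perp_def pol_add_left by simp

lemma perp_sum_left:
  assumes "finite S" "\<And>s. s \<in> S \<Longrightarrow> perp (f s) w"
  shows "perp (\<lambda>p q. \<Sum>s\<in>S. f s p q) w"
  using assms
proof (induction S)
  case empty
  show ?case by (simp add: perp_def pol_def)
next
  case (insert s S)
  thus ?case using perp_add_left[of "f s" w "\<lambda>p q. \<Sum>s\<in>S. f s p q"] by simp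
qed

lemma perp_polarize:
  fixes u v :: "'r \<Rightarrow> 'c \<Rightarrow> 'a::field"
  assumes two: "(2::'a) \<noteq> 0" and "perp u u" "perp v v" "perp (\<lambda>p q. u p q + v p q) (\<lambda>p q. u p q + v p q)"
  shows "perp u v"
  unfolding perp_def
proof (intro allI impI)
  fix r r' :: 'r and c c' :: 'c assume rc: "r \<noteq> r'" "c \<noteq> c'"
  have "2 * pol u v r r' c c' = 0"
    using assms(2-4)[THEN perpD, OF rc] unfolding pol_linear by (simp add: pol_sym[of v u])
  thus "pol u v r r' c c' = 0" using two unfolding mult_eq_0_iff by simp
qed

locale Lambda1_preserver =
  fixes n :: nat and \<Phi> :: "'a::field mat \<Rightarrow> 'a mat"
  assumes two: "(2::'a) \<noteq> 0"
    and carrier: "A \<in> carrier_mat n n \<Longrightarrow> \<Phi> A \<in> carrier_mat n n"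
    and additive: "A \<in> carrier_mat n n \<Longrightarrow> B \<in> carrier_mat n n \<Longrightarrow> \<Phi> (A + B) = \<Phi> A + \<Phi> B"
    and Lambda1: "A \<in> Lambda1 n \<Longrightarrow> \<Phi> A \<in> Lambda1 n"
begin

abbreviation \<psi> where "\<psi> A \<equiv> entries (\<Phi> A)"

definition \<phi> where "\<phi> i j a = \<psi> (single_mat n i j a)"

lemma \<psi>_add:
  "A \<in> carrier_mat n n \<Longrightarrow> B \<in> carrier_mat n n \<Longrightarrow> \<psi> (A + B) = (\<lambda>p q. \<psi> A p q + \<psi> B p q)"
  by (simp add: additive entries_add[OF carrier carrier])

lemma \<psi>_zero: "\<psi> (0\<^sub>m n n) p q = 0"
proof -
  have "\<psi> (0\<^sub>m n n + 0\<^sub>m n n) = (\<lambda>p q. \<psi> (0\<^sub>m n n) p q + \<psi> (0\<^sub>m n n) p q)"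
    by (rule \<psi>_add) simp_all
  hence "\<psi> (0\<^sub>m n n) p q = \<psi> (0\<^sub>m n n) p q + \<psi> (0\<^sub>m n n) p q"
    by (metis left_add_zero_mat zero_carrier_mat)
  thus ?thesis by (metis add_cancel_right_right)
qed

lemma perp_image:
  assumes "A \<in> carrier_mat n n" "A \<noteq> 0\<^sub>m n n \<Longrightarrow> A \<in> Lambda1 n"
  shows "perp (\<psi> A) (\<psi> A)"
proof (cases "A = 0\<^sub>m n n")
  case True
  thus ?thesis by (simp add: perp_def pol_def \<psi>_zero)
next
  case False
  thus ?thesis using assms Lambda1 Lambda1_entries_perp by blast
qed

lemma \<phi>_add: "\<phi> i j (a + b) p q = \<phi> i j a p q + \<phi> i j b p q"
proof -
  have "single_mat n i j (a + b) = single_mat n i j a + single_mat n i j b"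
    by (intro eq_matI) (auto simp: single_mat_def)
  thus ?thesis unfolding \<phi>_def by (simp add: \<psi>_add)
qed

lemma \<phi>_zero: "\<phi> i j 0 p q = 0"
  using \<phi>_add[of i j 0 0 p q] unfolding add_0_right by (metis add_cancel_right_right)

lemma \<phi>_minus: "\<phi> i j (- a) p q = - \<phi> i j a p q"
  using \<phi>_add[of i j "- a" a p q] \<phi>_zero[of i j p q] by (simp add: eq_neg_iff_add_eq_0)

lemma \<phi>_row:
  assumes "i < n" "j < n" "l < n"
  shows "perp (\<phi> i j a) (\<phi> i l b)"
proof -
  have iso: "perp (\<psi> A) (\<psi> A)" if "A \<in> carrier_mat n n" "\<And>p q. p < n \<Longrightarrow> q < n \<Longrightarrow> p \<noteq> i \<Longrightarrow> A $$ (p, q) = 0" for A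
    using that by (intro perp_image Lambda1_row[of A n i])
  have *: "perp (\<psi> (single_mat n i j a + single_mat n i l b)) (\<psi> (single_mat n i j a + single_mat n i l b))"
    by (rule iso) (simp_all add: single_mat_def)
  have self: "perp (\<phi> i j a) (\<phi> i j a)" "perp (\<phi> i l b) (\<phi> i l b)"
    unfolding \<phi>_def by (intro iso; simp)+
  have sum: "\<psi> (single_mat n i j a + single_mat n i l b) = (\<lambda>p q. \<phi> i j a p q + \<phi> i l b p q)"
    unfolding \<phi>_def by (rule \<psi>_add) simp_all
  show ?thesis by (rule perp_polarize[OF two self *[unfolded sum]])
qed

lemma \<phi>_col:
  assumes "i < n" "k < n" "j < n"
  shows "perp (\<phi> i j a) (\<phi> k j b)"
proof -
  have iso: "perp (\<psi> A) (\<psi> A)" if "A \<in> carrier_mat n n" "\<And>p q. p < n \<Longrightarrow> q < n \<Longrightarrow> q \<noteq> j \<Longrightarrow> A $$ (p, q) = 0" for A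
    using that by (intro perp_image Lambda1_col[of A n j])
  have *: "perp (\<psi> (single_mat n i j a + single_mat n k j b)) (\<psi> (single_mat n i j a + single_mat n k j b))"
    by (rule iso) (simp_all add: single_mat_def)
  have self: "perp (\<phi> i j a) (\<phi> i j a)" "perp (\<phi> k j b) (\<phi> k j b)"
    unfolding \<phi>_def by (intro iso; simp)+
  have sum: "\<psi> (single_mat n i j a + single_mat n k j b) = (\<lambda>p q. \<phi> i j a p q + \<phi> k j b p q)"
    unfolding \<phi>_def by (rule \<psi>_add) simp_all
  show ?thesis by (rule perp_polarize[OF two self *[unfolded sum]])
qed

text \<open>With the minus sign at \<open>b\<close>, the condition \<open>a * d = b * c\<close> says
  that the permanent of the block is zero.\<close>

lemma \<phi>_block_iso:
  assumes ik: "i < k" "k < n" and jl: "j < l" "l < n" and ad: "a * d = b * c"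
  defines "X \<equiv> (single_mat n i j a + single_mat n k l d) + (single_mat n i l (- b) + single_mat n k j c)"
  shows "perp (\<psi> X) (\<psi> X)"
proof (rule perp_image)
  show X: "X \<in> carrier_mat n n" by (simp add: X_def single_mat_def)
  assume "X \<noteq> 0\<^sub>m n n"
  thus "X \<in> Lambda1 n"
  proof (rule Lambda1_block[OF X _ ik jl])
    show "X $$ (p, q) = 0" if "p < n" "q < n" "p \<notin> {i, k} \<or> q \<notin> {j, l}" for p q
      using that by (auto simp: X_def single_mat_def)
    show "X $$ (i, j) * X $$ (k, l) + X $$ (i, l) * X $$ (k, j) = 0"
      using ik jl ad by (simp add: X_def single_mat_def)
  qed
qed

lemma \<phi>_block:
  assumes ik: "i < n" "k < n" "j < n" "l < n" "i \<noteq> k" "j \<noteq> l" and ad: "a * d = b * c"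
    and st: "s \<noteq> s'" "t \<noteq> t'"
  shows "pol (\<phi> i j a) (\<phi> k l d) s s' t t' = pol (\<phi> i l b) (\<phi> k j c) s s' t t'"
proof -
  let ?X = "(single_mat n i j a + single_mat n k l d) + (single_mat n i l (- b) + single_mat n k j c)"
  have X: "perp (\<psi> ?X) (\<psi> ?X)"
  proof -
    \<comment> \<open>\<open>\<phi>_block_iso\<close> expects increasing indices. In the other
      orders the same matrix is rewritten, with a double negation where that lemma asks for a minus
      sign.\<close>
    consider "i < k" "j < l" | "i < k" "l < j" | "k < i" "j < l" | "k < i" "l < j" using ik by linarith
    thus ?thesis
    proof cases
      case 1
      thus ?thesis using \<phi>_block_iso ik ad by blast
    next
      case 2
      have "?X = (single_mat n i l (- b) + single_mat n k j c) + (single_mat n i j (- (- a)) + single_mat n k l d)"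
        by (intro eq_matI) (auto simp: single_mat_def)
      thus ?thesis using \<phi>_block_iso[of i k l j "- b" c "- a" d] 2 ik ad by simp
    next
      case 3
      have "?X = (single_mat n k j c + single_mat n i l (- b)) + (single_mat n k l (- (- d)) + single_mat n i j a)"
        by (intro eq_matI) (auto simp: single_mat_def)
      thus ?thesis using \<phi>_block_iso[of k i j l c "- b" "- d" a] 3 ik ad by (simp add: mult.commute)
    next
      case 4
      have "?X = (single_mat n k l d + single_mat n i j a) + (single_mat n k j (- (- c)) + single_mat n i l (- b))"
        by (intro eq_matI) (auto simp: single_mat_def)
      thus ?thesis using \<phi>_block_iso[of k i l j d a "- c" "- b"] 4 ik ad by (simp add: mult.commute)
    qed
  qed
  have "\<psi> ?X = (\<lambda>p q. (\<phi> i j a p q + \<phi> k l d p q) + (\<phi> i l (- b) p q + \<phi> k j c p q))"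
    by (simp add: \<psi>_add \<phi>_def)
  \<comment> \<open>Of the polarised expression only the two diagonals of the block survive, since
    units in a common line have orthogonal images.\<close>
  moreover have "pol (\<phi> i' j' x) (\<phi> k' l' y) s s' t t' = 0" if "i' = k' \<or> j' = l'" "i' < n" "k' < n" "j' < n" "l' < n" for i' j' k' l' x y
    using that perpD[OF \<phi>_row st] perpD[OF \<phi>_col st] by auto
  ultimately have "2 * (pol (\<phi> i j a) (\<phi> k l d) s s' t t' + pol (\<phi> i l (- b)) (\<phi> k j c) s s' t t') = 0"
    using perpD[OF X st] ik by (simp add: pol_linear pol_sym[of "\<phi> k l d" "\<phi> i j a"] pol_sym[of "\<phi> k j c" "\<phi> i l (- b)"])
  hence "pol (\<phi> i j a) (\<phi> k l d) s s' t t' + pol (\<phi> i l (- b)) (\<phi> k j c) s s' t t' = 0"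
    using two unfolding mult_eq_0_iff by blast
  moreover have "pol (\<phi> i l (- b)) (\<phi> k j c) s s' t t' = - pol (\<phi> i l b) (\<phi> k j c) s s' t t'"
    unfolding pol_def \<phi>_minus by simp
  ultimately show ?thesis by simp
qed

lemma \<phi>_nonzero:
  assumes "i < n" "j < n" "a \<noteq> 0"
  shows "\<exists>p q. \<phi> i j a p q \<noteq> 0"
proof -
  have "single_mat n i j a \<noteq> 0\<^sub>m n n"
  proof
    assume "single_mat n i j a = 0\<^sub>m n n"
    hence "single_mat n i j a $$ (i, j) = 0\<^sub>m n n $$ (i, j)" by simp
    thus False using assms by simp
  qed
  hence "single_mat n i j a \<in> Lambda1 n"
    by (intro Lambda1_row[of _ _ i]) auto
  thus ?thesis unfolding \<phi>_def using Lambda1 Lambda1_nonzero by blast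
qed

sublocale perp_family "{..<n}" "{..<n}" \<phi>
  by unfold_locales (rule two \<phi>_add \<phi>_nonzero \<phi>_row \<phi>_col \<phi>_block; simp)+

lemma \<psi>_sum:
  assumes A: "A \<in> carrier_mat n n"
  shows "\<psi> A p q = (\<Sum>x\<in>{..<n} \<times> {..<n}. \<phi> (fst x) (snd x) (A $$ x) p q)"
proof -
  define R where "R S = mat n n (\<lambda>x. if x \<in> S then A $$ x else 0)" for S
  have "\<psi> (R S) p q = (\<Sum>x\<in>S. \<phi> (fst x) (snd x) (A $$ x) p q)" if "finite S" "S \<subseteq> {..<n} \<times> {..<n}" for S
    using that
  proof (induction S)
    case empty
    have "R {} = 0\<^sub>m n n" by (intro eq_matI) (auto simp: R_def)
    thus ?case by (simp add: \<psi>_zero)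
  next
    case (insert x S)
    have "R (insert x S) = single_mat n (fst x) (snd x) (A $$ x) + R S"
      using insert by (intro eq_matI) (auto simp: R_def)
    moreover have "R S \<in> carrier_mat n n" by (simp add: R_def)
    ultimately show ?case using insert by (simp add: \<psi>_add \<phi>_def)
  qed
  from this[of "{..<n} \<times> {..<n}"] have "\<psi> (R ({..<n} \<times> {..<n})) p q = (\<Sum>x\<in>{..<n} \<times> {..<n}. \<phi> (fst x) (snd x) (A $$ x) p q)"
    by simp
  moreover have "R ({..<n} \<times> {..<n}) = A" using A by (intro eq_matI) (auto simp: R_def)
  ultimately show ?thesis by simp
qed

end

section \<open>Entries of the products in the standard form\<close>

lemma map_matrix_carrier [simp]: "map_matrix n \<sigma> \<in> carrier_mat n n"
  by (simp add: map_matrix_def)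

lemma map_matrix_dims [simp]: "dim_row (map_matrix n \<sigma>) = n" "dim_col (map_matrix n \<sigma>) = n"
  by (simp_all add: map_matrix_def)

lemma map_matrix_index:
  assumes "k < n" "l < n"
  shows "(map_matrix n \<sigma> :: 'a::field mat) $$ (k, l) = (if l = \<sigma> k then 1 else 0)"
proof -
  have "(map_matrix n \<sigma> :: 'a mat) $$ (k, l) = (\<Sum>i<n. if k = i \<and> l = \<sigma> i then 1 else 0)"
    using assms by (simp add: map_matrix_def unit_matrix_def)
  also have "\<dots> = (\<Sum>i<n. if i = k then (if l = \<sigma> k then 1 else 0) else 0)"
    by (intro sum.cong) auto
  finally show ?thesis using assms by simp
qed

definition diagonal_matrix :: "nat \<Rightarrow> (nat \<Rightarrow> 'a::zero) \<Rightarrow> 'a mat" where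
  "diagonal_matrix n d = mat n n (\<lambda>(i, j). if i = j then d i else 0)"

lemma diagonal_matrix_carrier [simp]: "diagonal_matrix n d \<in> carrier_mat n n"
  by (simp add: diagonal_matrix_def)

lemma diagonal_matrix_index:
  "i < n \<Longrightarrow> j < n \<Longrightarrow> diagonal_matrix n d $$ (i, j) = (if i = j then d i else 0)"
  by (simp add: diagonal_matrix_def)

lemma nonsingular_diagonal_matrix:
  "(\<And>i. i < n \<Longrightarrow> d i \<noteq> 0) \<Longrightarrow> nonsingular_diagonal n (diagonal_matrix n d)"
  by (auto simp: nonsingular_diagonal_def diagonal_mat_def diagonal_matrix_def)

lemma mult_entry:
  assumes "A \<in> carrier_mat n n" "B \<in> carrier_mat n n" "p < n" "q < n"
  shows "(A * B) $$ (p, q) = (\<Sum>k<n. A $$ (p, k) * B $$ (k, q))"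
  using assms by (simp add: scalar_prod_def atLeast0LessThan)

text \<open>Shaped for comparison with \<open>\<psi>_sum\<close>: several entries of
  \<open>M\<close> may land at one place and are added up, as \<open>\<sigma>\<close> and
  \<open>\<tau>\<close> need not be injective.\<close>

lemma map_matrix_product_index:
  fixes M :: "'a::field mat"
  assumes M: "M \<in> carrier_mat n n" and pq: "p < n" "q < n"
  shows "(transpose_mat (map_matrix n \<sigma>) * diagonal_matrix n d * M * diagonal_matrix n e * map_matrix n \<tau>) $$ (p, q) =
    (\<Sum>x\<in>{..<n} \<times> {..<n}. if p = \<sigma> (fst x) \<and> q = \<tau> (snd x) then d (fst x) * e (snd x) * M $$ x else 0)"
proof -
  let ?T = "transpose_mat (map_matrix n \<sigma>) :: 'a mat" and ?D = "diagonal_matrix n d" and ?E = "diagonal_matrix n e"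
  have "?T \<in> carrier_mat n n" by simp
  note T = this mult_carrier_mat[OF this diagonal_matrix_carrier[of n d]]
  note T = T mult_carrier_mat[OF T(2) M] mult_carrier_mat[OF mult_carrier_mat[OF T(2) M] diagonal_matrix_carrier[of n e]]
  have TD: "(?T * ?D) $$ (p, i) = (if p = \<sigma> i then d i else 0)" if i: "i < n" for i
  proof -
    have "(?T * ?D) $$ (p, i) = (\<Sum>k<n. ?T $$ (p, k) * ?D $$ (k, i))"
      by (rule mult_entry) (use T pq i in auto)
    also have "\<dots> = (\<Sum>k<n. if k = i then (if p = \<sigma> i then d i else 0) else 0)"
      using pq i by (intro sum.cong) (auto simp: map_matrix_index diagonal_matrix_index)
    finally show ?thesis using i by simp
  qed
  have TDM: "(?T * ?D * M) $$ (p, j) = (\<Sum>i<n. (if p = \<sigma> i then d i else 0) * M $$ (i, j))" if j: "j < n" for j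
    using mult_entry[OF T(2) M pq(1) j] TD by simp
  have TDME: "(?T * ?D * M * ?E) $$ (p, j) = (?T * ?D * M) $$ (p, j) * e j" if j: "j < n" for j
  proof -
    have "(?T * ?D * M * ?E) $$ (p, j) = (\<Sum>k<n. (?T * ?D * M) $$ (p, k) * ?E $$ (k, j))"
      by (rule mult_entry) (use T pq j in auto)
    also have "\<dots> = (\<Sum>k<n. if k = j then (?T * ?D * M) $$ (p, j) * e j else 0)"
      using j by (intro sum.cong) (auto simp: diagonal_matrix_index)
    finally show ?thesis using j by simp
  qed
  have "(?T * ?D * M * ?E * map_matrix n \<tau>) $$ (p, q) =
      (\<Sum>j<n. (?T * ?D * M * ?E) $$ (p, j) * map_matrix n \<tau> $$ (j, q))"
    by (rule mult_entry) (use T pq in auto)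
  also have "\<dots> = (\<Sum>j<n. \<Sum>i<n. if p = \<sigma> i \<and> q = \<tau> j then d i * e j * M $$ (i, j) else 0)"
  proof (intro sum.cong refl)
    fix j assume "j \<in> {..<n}"
    hence j: "j < n" by simp
    show "(?T * ?D * M * ?E) $$ (p, j) * map_matrix n \<tau> $$ (j, q) =
      (\<Sum>i<n. if p = \<sigma> i \<and> q = \<tau> j then d i * e j * M $$ (i, j) else 0)"
      unfolding TDME[OF j] TDM[OF j] sum_distrib_right
      using j pq by (intro sum.cong) (auto simp: map_matrix_index)
  qed
  also have "\<dots> = (\<Sum>i<n. \<Sum>j<n. if p = \<sigma> i \<and> q = \<tau> j then d i * e j * M $$ (i, j) else 0)"
    by (rule sum.swap)
  also have "\<dots> = (\<Sum>x\<in>{..<n} \<times> {..<n}. if p = \<sigma> (fst x) \<and> q = \<tau> (snd x) then d (fst x) * e (snd x) * M $$ x else 0)"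
    unfolding sum.cartesian_product by (intro sum.cong) auto
  finally show ?thesis .
qed

text \<open>An index out of range only occurs for the zero matrix, and any index then serves.\<close>
lemma row_mats_if_supp:
  assumes "A \<in> carrier_mat n n" "supp_in (entries A) {r} UNIV"
  shows "A \<in> row_mats n (if r < n then r else 0)"
proof -
  have "A $$ (p, q) = 0" if "p < n" "q < n" "p \<noteq> r" for p q
    using supp_inD[OF assms(2), of p q] that assms(1) by (simp add: entries_def)
  thus ?thesis using assms(1) by (auto simp: row_mats_def)
qed

lemma col_mats_if_supp:
  assumes "A \<in> carrier_mat n n" "supp_in (entries A) UNIV {c}"
  shows "A \<in> col_mats n (if c < n then c else 0)"
proof -
  have "A $$ (p, q) = 0" if "p < n" "q < n" "q \<noteq> c" for p q
    using supp_inD[OF assms(2), of p q] that assms(1) by (simp add: entries_def)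
  thus ?thesis using assms(1) by (auto simp: col_mats_def)
qed

lemma block_mats_if_supp:
  fixes A :: "'a::field mat"
  assumes A: "A \<in> carrier_mat n n" and supp: "supp_in (entries A) {r, r'} {c, c'}"
  defines "f \<equiv> \<lambda>k. if k < n then k else (0::nat)"
  shows "A \<in> (row_mats n (f r) + row_mats n (f r')) \<inter> (col_mats n (f c) + col_mats n (f c'))"
proof
  have z: "A $$ (p, q) = 0" if "p < n" "q < n" "p \<notin> {r, r'} \<or> q \<notin> {c, c'}" for p q
    using supp_inD[OF supp that(3)] that A by (simp add: entries_def)
  have f: "k \<notin> {a, b}" if "k < n" "k \<noteq> f a" "k \<noteq> f b" for k a b
    using that by (auto simp: f_def)
  let ?B = "mat n n (\<lambda>(p, q). if p = f r then A $$ (p, q) else 0)"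
  let ?C = "mat n n (\<lambda>(p, q). if p = f r then 0 else A $$ (p, q))"
  have sum: "A = ?B + ?C" using A by (intro eq_matI) auto
  have "?B \<in> row_mats n (f r)" by (auto simp: row_mats_def)
  moreover have "?C \<in> row_mats n (f r')" using z[OF _ _ disjI1[OF f]] by (auto simp: row_mats_def)
  ultimately show "A \<in> row_mats n (f r) + row_mats n (f r')" by (subst sum) (rule set_plus_intro)
  let ?B = "mat n n (\<lambda>(p, q). if q = f c then A $$ (p, q) else 0)"
  let ?C = "mat n n (\<lambda>(p, q). if q = f c then 0 else A $$ (p, q))"
  have sum: "A = ?B + ?C" using A by (intro eq_matI) auto
  have "?B \<in> col_mats n (f c)" by (auto simp: col_mats_def)
  moreover have "?C \<in> col_mats n (f c')" using z[OF _ _ disjI2[OF f]] by (auto simp: col_mats_def)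
  ultimately show "A \<in> col_mats n (f c) + col_mats n (f c')" by (subst sum) (rule set_plus_intro)
qed

section \<open>From the images of units back to the whole map\<close>

context Lambda1_preserver
begin

lemma \<phi>_bound: "\<phi> i j a p q \<noteq> 0 \<Longrightarrow> p < n \<and> q < n"
  using carrier[OF single_mat_carrier[of n i j a]] by (auto simp: \<phi>_def entries_def split: if_splits)

definition degenerate where
  "degenerate \<longleftrightarrow> (\<exists>i\<in>{..<n}. \<exists>j\<in>{..<n}. \<exists>i'\<in>{..<n}. \<exists>j'\<in>{..<n}.
      \<Phi> ` carrier_mat n n \<subseteq> row_mats n i
    \<or> \<Phi> ` carrier_mat n n \<subseteq> col_mats n j
    \<or> \<Phi> ` carrier_mat n n \<subseteq> (row_mats n i + row_mats n i') \<inter> (col_mats n j + col_mats n j'))"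

lemma degenerateI:
  assumes "i < n" "j < n" "i' < n" "j' < n"
    and "\<Phi> ` carrier_mat n n \<subseteq> row_mats n i \<or> \<Phi> ` carrier_mat n n \<subseteq> col_mats n j
      \<or> \<Phi> ` carrier_mat n n \<subseteq> (row_mats n i + row_mats n i') \<inter> (col_mats n j + col_mats n j')"
  shows degenerate
  unfolding degenerate_def
  by (rule bexI[of _ i], rule bexI[of _ j], rule bexI[of _ i'], rule bexI[of _ j'], rule assms(5))
    (simp_all add: assms)

lemma degenerate_row:
  assumes "0 < n" "\<And>A. A \<in> carrier_mat n n \<Longrightarrow> supp_in (\<psi> A) {r} UNIV"
  shows degenerate
proof -
  have "\<Phi> ` carrier_mat n n \<subseteq> row_mats n (if r < n then r else 0)"
    using row_mats_if_supp carrier assms(2) by blast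
  \<comment> \<open>All four indices are quantified jointly; those that the chosen alternative does
    not mention are set to \<open>0\<close>.\<close>
  from degenerateI[OF _ _ _ _ disjI1[OF this], of 0 0 0] show ?thesis using assms(1) by simp
qed

lemma degenerate_col:
  assumes "0 < n" "\<And>A. A \<in> carrier_mat n n \<Longrightarrow> supp_in (\<psi> A) UNIV {c}"
  shows degenerate
proof -
  have "\<Phi> ` carrier_mat n n \<subseteq> col_mats n (if c < n then c else 0)"
    using col_mats_if_supp carrier assms(2) by blast
  from degenerateI[OF _ _ _ _ disjI2[OF disjI1[OF this]], of 0 0 0] show ?thesis using assms(1) by simp
qed

lemma degenerate_block:
  assumes "0 < n" "\<And>A. A \<in> carrier_mat n n \<Longrightarrow> supp_in (\<psi> A) {r, r'} {c, c'}"
  shows degenerate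
proof -
  define f where "f k = (if k < n then k else 0)" for k
  have "\<Phi> ` carrier_mat n n \<subseteq> (row_mats n (f r) + row_mats n (f r')) \<inter> (col_mats n (f c) + col_mats n (f c'))"
    unfolding f_def using block_mats_if_supp[OF carrier assms(2)] by blast
  moreover have "f k < n" for k using assms(1) by (simp add: f_def)
  ultimately show ?thesis by (intro degenerateI[of "f r" "f c" "f r'" "f c'"]) auto
qed

lemma degenerate_if_perp:
  assumes n: "0 < n" and perp: "\<And>i j k l a d. i < n \<Longrightarrow> j < n \<Longrightarrow> k < n \<Longrightarrow> l < n \<Longrightarrow> perp (\<phi> i j a) (\<phi> k l d)"
  shows degenerate
proof -
  let ?G = "\<psi> ` carrier_mat n n"
  have "perp (\<psi> A) (\<psi> B)" if A: "A \<in> carrier_mat n n" and B: "B \<in> carrier_mat n n" for A B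
  proof -
    have sums: "\<psi> C = (\<lambda>p q. \<Sum>x\<in>{..<n} \<times> {..<n}. \<phi> (fst x) (snd x) (C $$ x) p q)"
      if "C \<in> carrier_mat n n" for C using \<psi>_sum[OF that] by blast
    have "perp (\<psi> B) (\<phi> i j a)" if "i < n" "j < n" for i j a
      unfolding sums[OF B] using that perp by (intro perp_sum_left) auto
    hence "perp (\<phi> i j a) (\<psi> B)" if "i < n" "j < n" for i j a
      using that perp_sym by blast
    thus ?thesis unfolding sums[OF A] by (intro perp_sum_left) auto
  qed
  moreover have "(\<lambda>p q. u p q + v p q) \<in> ?G" if uv: "u \<in> ?G" "v \<in> ?G" for u v
  proof -
    obtain A B where "A \<in> carrier_mat n n" "B \<in> carrier_mat n n" "u = \<psi> A" "v = \<psi> B" using uv by blast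
    thus ?thesis using \<psi>_add[of A B] by (intro image_eqI[of _ _ "A + B"]) auto
  qed
  ultimately have "(\<exists>r. \<forall>u\<in>?G. supp_in u {r} UNIV) \<or> (\<exists>c. \<forall>u\<in>?G. supp_in u UNIV {c}) \<or>
     (\<exists>r r' c c'. \<forall>u\<in>?G. supp_in u {r, r'} {c, c'})"
    by (intro isotropic_group[OF two]) auto
  thus ?thesis
  proof (elim disjE exE)
    fix r assume "\<forall>u\<in>?G. supp_in u {r} UNIV"
    thus ?thesis by (intro degenerate_row[OF n]) blast
  next
    fix c assume "\<forall>u\<in>?G. supp_in u UNIV {c}"
    thus ?thesis by (intro degenerate_col[OF n]) blast
  next
    fix r r' c c' assume "\<forall>u\<in>?G. supp_in u {r, r'} {c, c'}"
    thus ?thesis by (intro degenerate_block[OF n, of r r' c c']) blast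
  qed
qed

definition standard where
  "standard \<sigma> \<tau> D1 D2 h \<longleftrightarrow> \<sigma> \<in> {..<n} \<rightarrow> {..<n} \<and> \<tau> \<in> {..<n} \<rightarrow> {..<n}
    \<and> nonsingular_diagonal n D1 \<and> nonsingular_diagonal n D2
    \<and> field_endomorphism h \<and> (\<exists>x. h x \<noteq> (0::'a))"

lemma standardI:
  assumes "0 < n" and d: "\<And>m. m \<in> {..<n} \<Longrightarrow> d m \<noteq> 0" and e: "\<And>m. m \<in> {..<n} \<Longrightarrow> e m \<noteq> (0::'a)"
    and h: "h 1 = 1" "\<And>a b. h (a + b) = h a + h b" "\<And>a b. h (a * b) = h a * h b"
    and bound: "\<And>i j. i < n \<Longrightarrow> j < n \<Longrightarrow> \<sigma> i < n \<and> \<tau> j < n"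
  shows "standard \<sigma> \<tau> (diagonal_matrix n d) (diagonal_matrix n e) h"
proof -
  have "h 1 \<noteq> 0" using h(1) by simp
  hence "\<exists>x. h x \<noteq> 0" by blast
  thus ?thesis
    unfolding standard_def field_endomorphism_def
    using d e h bound assms(1) by (auto intro!: nonsingular_diagonal_matrix)
qed

lemma standard_if_cells:
  assumes ijkl: "i \<in> {..<n}" "k \<in> {..<n}" "j \<in> {..<n}" "l \<in> {..<n}" and cells: "cells i k j l"
  obtains \<sigma> \<tau> D1 D2 h where "standard \<sigma> \<tau> D1 D2 h"
    "\<And>A. A \<in> carrier_mat n n \<Longrightarrow>
       \<Phi> A = transpose_mat (map_matrix n \<sigma>) * D1 * map_mat h A * D2 * map_matrix n \<tau>"
proof -
  obtain \<sigma> \<tau> d e h where d: "\<And>m. m \<in> {..<n} \<Longrightarrow> d m \<noteq> 0" and e: "\<And>m. m \<in> {..<n} \<Longrightarrow> e m \<noteq> 0"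
    and h: "h 1 = (1::'a)" "\<And>a b. h (a + b) = h a + h b" "\<And>a b. h (a * b) = h a * h b"
    and \<phi>: "\<And>m n' a p q. m \<in> {..<n} \<Longrightarrow> n' \<in> {..<n} \<Longrightarrow>
      \<phi> m n' a p q = (if p = \<sigma> m \<and> q = \<tau> n' then d m * e n' * h a else 0)"
    by (rule cells_formula[OF ijkl cells]) (rule that)
  \<comment> \<open>\<open>cells_formula\<close> does not bound the positions. They are in range
    because a nonzero value occurs there and \<open>entries\<close> is \<open>0\<close> outside the
    matrix.\<close>
  have bound: "\<sigma> m < n \<and> \<tau> m' < n" if "m < n" "m' < n" for m m'
    using \<phi>[of m m' 1 "\<sigma> m" "\<tau> m'"] \<phi>_bound[of m m' 1 "\<sigma> m" "\<tau> m'"] d[of m] e[of m'] h(1) that by simp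
  have "\<Phi> A = transpose_mat (map_matrix n \<sigma>) * diagonal_matrix n d * map_mat h A * diagonal_matrix n e * map_matrix n \<tau>"
    (is "_ = ?R") if A: "A \<in> carrier_mat n n" for A
  proof (rule eq_matI)
    have dims: "dim_row ?R = n" "dim_col ?R = n"
      by simp_all
    show "dim_row (\<Phi> A) = dim_row ?R" "dim_col (\<Phi> A) = dim_col ?R"
      using carrier[OF A] dims by auto
    fix p q assume "p < dim_row ?R" "q < dim_col ?R"
    hence pq: "p < n" "q < n" using dims by auto
    have "\<Phi> A $$ (p, q) = \<psi> A p q" using carrier[OF A] pq by (simp add: entries_def)
    also have "\<dots> = (\<Sum>x\<in>{..<n} \<times> {..<n}. if p = \<sigma> (fst x) \<and> q = \<tau> (snd x)
      then d (fst x) * e (snd x) * map_mat h A $$ x else 0)"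
      unfolding \<psi>_sum[OF A] using A by (intro sum.cong refl) (auto simp: \<phi>)
    also have "\<dots> = ?R $$ (p, q)"
      using A pq by (intro map_matrix_product_index[symmetric]) auto
    finally show "\<Phi> A $$ (p, q) = ?R $$ (p, q)" .
  qed
  moreover have "standard \<sigma> \<tau> (diagonal_matrix n d) (diagonal_matrix n e) h"
    by (rule standardI) (use ijkl d e h bound in auto)
  ultimately show ?thesis using that by blast
qed

text \<open>With transposed images \<open>cells_formula\<close> applies, but its row map then
  describes the columns of the true image. Hence \<open>\<sigma>, \<tau>\<close> and
  \<open>d, e\<close> change sides.\<close>

lemma standard_if_cells_transposed:
  assumes ijkl: "i \<in> {..<n}" "k \<in> {..<n}" "j \<in> {..<n}" "l \<in> {..<n}" and cells: "cells_transposed i k j l"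
  obtains \<sigma> \<tau> D1 D2 h where "standard \<sigma> \<tau> D1 D2 h"
    "\<And>A. A \<in> carrier_mat n n \<Longrightarrow>
       \<Phi> A = transpose_mat (map_matrix n \<sigma>) * D1 * transpose_mat (map_mat h A) * D2 * map_matrix n \<tau>"
proof -
  interpret T: perp_family "{..<n}" "{..<n}" "\<lambda>i j a. tr (\<phi> i j a)"
    by (rule transpose_out)
  have T: "T.cells i k j l"
    using cells by (rule cells_transposedE) (rule T.cellsI; simp)
  obtain \<sigma> \<tau> d e h where d: "\<And>m. m \<in> {..<n} \<Longrightarrow> d m \<noteq> 0" and e: "\<And>m. m \<in> {..<n} \<Longrightarrow> e m \<noteq> 0"
    and h: "h 1 = (1::'a)" "\<And>a b. h (a + b) = h a + h b" "\<And>a b. h (a * b) = h a * h b"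
    and tr: "\<And>m n' a p q. m \<in> {..<n} \<Longrightarrow> n' \<in> {..<n} \<Longrightarrow>
      tr (\<phi> m n' a) p q = (if p = \<sigma> m \<and> q = \<tau> n' then d m * e n' * h a else 0)"
    by (rule T.cells_formula[OF ijkl T]) (rule that)
  have \<phi>: "\<phi> m n' a p q = (if q = \<sigma> m \<and> p = \<tau> n' then d m * e n' * h a else 0)"
    if "m < n" "n' < n" for m n' a p q
    using tr[of m n' a q p] that by (simp add: tr_def)
  have bound: "\<tau> m' < n \<and> \<sigma> m < n" if "m' < n" "m < n" for m m'
    using \<phi>[of m m' 1 "\<tau> m'" "\<sigma> m"] \<phi>_bound[of m m' 1 "\<tau> m'" "\<sigma> m"] d[of m] e[of m'] h(1) that by simp
  have "\<Phi> A = transpose_mat (map_matrix n \<tau>) * diagonal_matrix n e * transpose_mat (map_mat h A) * diagonal_matrix n d * map_matrix n \<sigma>"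
    (is "_ = ?R") if A: "A \<in> carrier_mat n n" for A
  proof (rule eq_matI)
    have dims: "dim_row ?R = n" "dim_col ?R = n"
      by simp_all
    show "dim_row (\<Phi> A) = dim_row ?R" "dim_col (\<Phi> A) = dim_col ?R"
      using carrier[OF A] dims by auto
    fix p q assume "p < dim_row ?R" "q < dim_col ?R"
    hence pq: "p < n" "q < n" using dims by auto
    have "\<Phi> A $$ (p, q) = \<psi> A p q" using carrier[OF A] pq by (simp add: entries_def)
    also have "\<dots> = (\<Sum>x\<in>{..<n} \<times> {..<n}. if q = \<sigma> (fst x) \<and> p = \<tau> (snd x)
      then d (fst x) * e (snd x) * h (A $$ x) else 0)"
      unfolding \<psi>_sum[OF A] by (intro sum.cong refl) (auto simp: \<phi>)
    also have "\<dots> = (\<Sum>x\<in>{..<n} \<times> {..<n}. if p = \<tau> (fst x) \<and> q = \<sigma> (snd x)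
      then e (fst x) * d (snd x) * transpose_mat (map_mat h A) $$ x else 0)"
      using A by (intro sum.reindex_bij_witness[of _ prod.swap prod.swap]) auto
    also have "\<dots> = ?R $$ (p, q)"
      using A pq by (intro map_matrix_product_index[symmetric]) auto
    finally show "\<Phi> A $$ (p, q) = ?R $$ (p, q)" .
  qed
  moreover have "standard \<tau> \<sigma> (diagonal_matrix n e) (diagonal_matrix n d) h"
    by (rule standardI) (use ijkl d e h bound in auto)
  ultimately show ?thesis using that by blast
qed

lemma classification:
  assumes n: "0 < n"
  shows "degenerate \<or> (\<exists>\<sigma> \<tau> D1 D2 h. standard \<sigma> \<tau> D1 D2 h \<and>
     ((\<forall>A\<in>carrier_mat n n. \<Phi> A = transpose_mat (map_matrix n \<sigma>) * D1 * map_mat h A * D2 * map_matrix n \<tau>) \<or>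
      (\<forall>A\<in>carrier_mat n n. \<Phi> A =
         transpose_mat (map_matrix n \<sigma>) * D1 * transpose_mat (map_mat h A) * D2 * map_matrix n \<tau>)))"
proof (rule trichotomy)
  assume "\<And>i j k l a d. i \<in> {..<n} \<Longrightarrow> j \<in> {..<n} \<Longrightarrow> k \<in> {..<n} \<Longrightarrow> l \<in> {..<n} \<Longrightarrow> perp (\<phi> i j a) (\<phi> k l d)"
  thus ?thesis by (intro disjI1 degenerate_if_perp[OF n]) simp
next
  fix r r' c c' assume supp: "\<And>i j a. i \<in> {..<n} \<Longrightarrow> j \<in> {..<n} \<Longrightarrow> supp_in (\<phi> i j a) {r, r'} {c, c'}"
  have "supp_in (\<psi> A) {r, r'} {c, c'}" if A: "A \<in> carrier_mat n n" for A
    unfolding supp_in_def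
  proof (intro allI impI, rule ccontr)
    fix p q assume "\<psi> A p q \<noteq> 0" and out: "\<not> (p \<in> {r, r'} \<and> q \<in> {c, c'})"
    moreover have "\<phi> (fst x) (snd x) (A $$ x) p q = 0" if "x \<in> {..<n} \<times> {..<n}" for x
      using out that by (intro supp_inD[OF supp]) auto
    ultimately show False unfolding \<psi>_sum[OF A] by simp
  qed
  thus ?thesis by (intro disjI1 degenerate_block[OF n])
next
  fix i k j l assume "i \<in> {..<n}" "k \<in> {..<n}" "j \<in> {..<n}" "l \<in> {..<n}" "cells i k j l"
  note ijkl = this
  obtain \<sigma> \<tau> D1 D2 h where st: "standard \<sigma> \<tau> D1 D2 h"
    "\<And>A. A \<in> carrier_mat n n \<Longrightarrow>
       \<Phi> A = transpose_mat (map_matrix n \<sigma>) * D1 * map_mat h A * D2 * map_matrix n \<tau>"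
    by (rule standard_if_cells[OF ijkl]) (rule that)
  show ?thesis
    by (rule disjI2, rule exI[of _ \<sigma>], rule exI[of _ \<tau>], rule exI[of _ D1], rule exI[of _ D2],
        rule exI[of _ h], rule conjI[OF st(1)], rule disjI1, rule ballI, rule st(2))
next
  fix i k j l assume "i \<in> {..<n}" "k \<in> {..<n}" "j \<in> {..<n}" "l \<in> {..<n}" "cells_transposed i k j l"
  note ijkl = this
  obtain \<sigma> \<tau> D1 D2 h where st: "standard \<sigma> \<tau> D1 D2 h"
    "\<And>A. A \<in> carrier_mat n n \<Longrightarrow>
       \<Phi> A = transpose_mat (map_matrix n \<sigma>) * D1 * transpose_mat (map_mat h A) * D2 * map_matrix n \<tau>"
    by (rule standard_if_cells_transposed[OF ijkl]) (rule that)
  show ?thesis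
    by (rule disjI2, rule exI[of _ \<sigma>], rule exI[of _ \<tau>], rule exI[of _ D1], rule exI[of _ D2],
        rule exI[of _ h], rule conjI[OF st(1)], rule disjI2, rule ballI, rule st(2))
qed

end

theorem theorem1p3:
  fixes n :: nat and \<Phi> :: "'a::field mat \<Rightarrow> 'a mat"
  assumes "CHAR('a) \<noteq> 2"
    and "n \<ge> 3"
    and "\<Phi> \<in> carrier_mat n n \<rightarrow> carrier_mat n n"
    and "\<forall>A\<in>carrier_mat n n. \<forall>B\<in>carrier_mat n n. \<Phi> (A + B) = \<Phi> A + \<Phi> B"
    and "\<Phi> ` Lambda1 n \<subseteq> Lambda1 n"
  shows "(\<exists>i\<in>{..<n}. \<exists>j\<in>{..<n}. \<exists>i'\<in>{..<n}. \<exists>j'\<in>{..<n}.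
            \<Phi> ` carrier_mat n n \<subseteq> row_mats n i
          \<or> \<Phi> ` carrier_mat n n \<subseteq> col_mats n j
          \<or> \<Phi> ` carrier_mat n n
              \<subseteq> (row_mats n i + row_mats n i') \<inter> (col_mats n j + col_mats n j'))
       \<or> (\<exists>\<sigma> \<tau> D1 D2 \<phi>.
            \<sigma> \<in> {..<n} \<rightarrow> {..<n} \<and> \<tau> \<in> {..<n} \<rightarrow> {..<n}
          \<and> nonsingular_diagonal n D1 \<and> nonsingular_diagonal n D2
          \<and> field_endomorphism \<phi> \<and> (\<exists>x. \<phi> x \<noteq> 0)
          \<and> ((\<forall>A\<in>carrier_mat n n. \<Phi> A =
                 transpose_mat (map_matrix n \<sigma>) * D1 * map_mat \<phi> A * D2 * map_matrix n \<tau>)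
           \<or> (\<forall>A\<in>carrier_mat n n. \<Phi> A =
                 transpose_mat (map_matrix n \<sigma>) * D1 * transpose_mat (map_mat \<phi> A) * D2
                   * map_matrix n \<tau>)))"
proof -
  have "(2::'a) \<noteq> 0"
  proof
    assume "(2::'a) = 0"
    hence "of_nat 2 = (0::'a)" by simp
    hence "CHAR('a) dvd 2" by (simp only: of_nat_eq_0_iff_char_dvd)
    hence "CHAR('a) \<le> 2" by (rule dvd_imp_le) simp
    moreover have "CHAR('a) \<noteq> 0" using \<open>CHAR('a) dvd 2\<close> by (metis dvd_0_left_iff zero_neq_numeral)
    moreover have "CHAR('a) \<noteq> 1" by simp
    ultimately show False using assms(1) by linarith
  qed
  then interpret Lambda1_preserver n \<Phi>
    by unfold_locales (use assms(3-5) in auto)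
  show ?thesis
    using classification assms(2) unfolding degenerate_def standard_def by auto
qed

end
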